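(* Let $K\subset\overline{\mathbb{Q}}$ be a CM field with maximal totally real subfield $F$, and let $\Phi\subset\Sigma_K=\mathrm{Hom}_{\mathbb{Q}}(K,\overline{\mathbb{Q}})$ be a CM type of $K$. Let $(w_\rho)_{\rho\in\Sigma_K}$ be a set of coset representatives for $\Gamma_K$ in $\Gamma_{\mathbb{Q}}$ (so $w_\rho|_K=\rho$) such that $w_{c\rho}=c\,w_\rho$ for all $\rho\in\Sigma_K$. Then Nekovář's half-transfer map $\widetilde{F_\Phi}:\mathrm{Aut}_F(F\otimes_{\mathbb{Q}}\overline{\mathbb{Q}})\to\Gamma_K^{ab}$ sends any $g\in \mathrm{Aut}_F(F\otimes_{\mathbb{Q}}\overline{\mathbb{Q}})$ to $$\widetilde{F_\Phi}(g)=\prod_{\phi\in\Phi}w_{\alpha_g\phi}^{-1}\,\alpha_g(w_\phi)\ \bmod \Gamma_{K^{ab}}\ \in\Gamma_K^{ab},$$ where $\alpha_g\in\Gamma_{\mathbb{Q}}\#\Gamma_F\subset\Gamma_{\mathbb{Q}}\#\Gamma_K$ is the image of $g$ under the canonical isomorphism $\mathrm{Aut}_F(F\otimes_{\mathbb{Q}}\overline{\mathbb{Q}})\xrightarrow{\sim}\Gamma_{\mathbb{Q}}\#\Gamma_F$.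
   Context: $\overline{\mathbb{Q}}$ is the algebraic closure of $\mathbb{Q}$ in $\mathbb{C}$, $\Gamma_L=\mathrm{Gal}(\overline{\mathbb{Q}}/L)$ for $L \subset \overline{\mathbb{Q}}$, and $c\in\Gamma_{\mathbb{Q}}$ is complex conjugation. $\Sigma_K$ is identified with $\Gamma_{\mathbb{Q}}/\Gamma_K$, and $\Gamma_K^{ab}=\Gamma_K/\Gamma_{K^{ab}}=\mathrm{Gal}(K^{ab}/K)$. Plectic groups. For a group $G$ and a subgroup $H$ of finite index, $G\#H$ is the group (under composition) of bijections $\alpha:G\to G$ with $\alpha(gh)=\alpha(g)h$ for all $g\in G$, $h\in H$. Such $\alpha$ induces a permutation $x\mapsto\alpha x$ of $G/H$. If $H'\subset H$ then $G\#H\subset G\#H'$. In particular $\alpha\in\Gamma_{\mathbb{Q}}\#\Gamma_K$ permutes $\Sigma_K=\Gamma_{\mathbb{Q}}/\Gamma_K$, written $\rho\mapsto\alpha\rho$, and $w_{\alpha\rho}^{-1}\alpha(w_\rho)\in\Gamma_K$. Canonical isomorphism. Let $X=\Sigma_F=\mathrm{Hom}_{\mathbb{Q}}(F,\overline{\mathbb{Q}})=\Gamma_{\mathbb{Q}}/\Gamma_F$ and let $s=(s_x)_{x\in X}$ be coset representatives for $\Gamma_F$ in $\Gamma_{\mathbb{Q}}$. Identify $F\otimes_{\mathbb{Q}}\overline{\mathbb{Q}}\cong\prod_{x\in X}\overline{\mathbb{Q}}$ via $a\otimes b\mapsto(x(a)b)_x$. Every $g\in\mathrm{Aut}_F(F\otimes_{\mathbb{Q}}\overline{\mathbb{Q}})$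 ($F$-algebra automorphisms) has the form $g((s_x(a_x))_x)=(s_x(b_x))_x$ with $b_{\pi(x)}=h_x(a_x)$ for unique $\pi\in S_X$, $h_x\in\Gamma_F$; put $\beta_s(g)=(\pi,(h_x)_x)\in S_X\ltimes\Gamma_F^X$. For $\alpha\in\Gamma_{\mathbb{Q}}\#\Gamma_F$ put $\rho_s(\alpha)=(\pi,(s_{\pi(x)}^{-1}\alpha(s_x))_x)$, where $\pi$ is the permutation of $X$ induced by $\alpha$. Both $\beta_s$ and $\rho_s$ are isomorphisms onto $S_X\ltimes\Gamma_F^X$ and $g\mapsto\alpha_g:=\rho_s^{-1}(\beta_s(g))$ is independent of $s$; this is the canonical isomorphism. Nekovář's half-transfer map. Let $s=(s_x)_{x\in X}$ be a set of coset representatives for $\Gamma_F$ in $\Gamma_{\mathbb{Q}}$, where $X=\Sigma_F=\Gamma_{\mathbb{Q}}/\Gamma_F$, and write $\Phi=\{c^{a_x}s_x|_K: x\in X\}$ with unique $a=(a_x)\in(\mathbb{Z}/2\mathbb{Z})^X$. For $h\in\Gamma_F$ define $\overline h\in\mathbb{Z}/2\mathbb{Z}$ by $h|_K=c^{\overline h}|_K$. If $\beta_s(g)=(\pi,(h_x)_x)$, then by definition $$\widetilde{F_\Phi}(g)=\prod_{x\in X}s_{\pi(x)}^{-1}c^{a_x+\overline{h_x}}s_{\pi(x)}\,h_x\,s_x^{-1}c^{a_x}s_x\big|_{K^{ab}}\in\Gamma_K^{ab};$$ this is known to be independent of the choice of $s$. *)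

theory Defs
  imports Complex_Main "HOL-Algebra.Algebra" "HOL-Algebra.Algebraic_Closure_Type"
    "HOL-Library.Z2"
begin

section \<open>Number fields in the complex numbers and their embeddings\<close>

abbreviation CC :: "complex ring" where
  "CC \<equiv> ring_of_type_algebra"

abbreviation field_on :: "complex set \<Rightarrow> complex ring" where
  "field_on L \<equiv> CC\<lparr>carrier := L\<rparr>"

definition Qbar :: "complex set" where
  "Qbar = {z. algebraic z}"

definition number_field :: "complex set \<Rightarrow> bool" where
  "number_field L \<longleftrightarrow> subfield L CC \<and> ring.finite_dimension CC \<rat> L"

text \<open>
  \<open>embs L\<close> is \<open>\<Sigma>\<^sub>L\<close>. Its elements are extensional (undefined outside \<open>L\<close>), so that
  equality of embeddings is equality of functions; their \<open>\<rat>\<close>-linearity is automatic.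
\<close>

definition embs :: "complex set \<Rightarrow> (complex \<Rightarrow> complex) set" where
  "embs L = extensional L \<inter> ring_hom (field_on L) (field_on Qbar)"


section \<open>Galois groups\<close>

definition Gal :: "complex set \<Rightarrow> complex set \<Rightarrow> (complex \<Rightarrow> complex) monoid" where
  "Gal E L = (BijGroup E)\<lparr>carrier :=
     {\<sigma> \<in> Bij E. \<sigma> \<in> ring_hom (field_on E) (field_on E) \<and> (\<forall>z\<in>L. \<sigma> z = z)}\<rparr>"

definition \<Gamma> :: "complex set \<Rightarrow> (complex \<Rightarrow> complex) monoid" where
  "\<Gamma> L = Gal Qbar L"

abbreviation \<Gamma>Q :: "(complex \<Rightarrow> complex) monoid" where
  "\<Gamma>Q \<equiv> \<Gamma> \<rat>"

definition conj_Q :: "complex \<Rightarrow> complex" where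
  "conj_Q = (\<lambda>z\<in>Qbar. cnj z)"

text \<open>The power \<open>c\<^sup>e\<close> of complex conjugation, for \<open>e\<close> in \<open>\<int>/2\<int>\<close>.\<close>

definition conj_pow :: "bit \<Rightarrow> complex \<Rightarrow> complex" where
  "conj_pow e = (if e = 0 then \<one>\<^bsub>\<Gamma>Q\<^esub> else conj_Q)"

text \<open>
  Galois means normal here: separability is automatic in characteristic zero, and
  \<open>L \<subseteq> Qbar\<close> is algebraic. The extension \<open>L\<close> of \<open>K\<close> may be infinite.
\<close>

definition abelian_extension :: "complex set \<Rightarrow> complex set \<Rightarrow> bool" where
  "abelian_extension K L \<longleftrightarrow>
     subfield L CC \<and> K \<subseteq> L \<and> L \<subseteq> Qbar \<and>
     (\<forall>\<tau>\<in>embs L. (\<forall>z\<in>K. \<tau> z = z) \<longrightarrow> \<tau> ` L = L) \<and>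
     comm_group (Gal L K)"

definition max_abelian_extension :: "complex set \<Rightarrow> complex set" where
  "max_abelian_extension K = \<Union> {L. abelian_extension K L}"

definition \<Gamma>_ab :: "complex set \<Rightarrow> (complex \<Rightarrow> complex) set monoid" where
  "\<Gamma>_ab K = \<Gamma> K Mod carrier (\<Gamma> (max_abelian_extension K))"

definition to_ab :: "complex set \<Rightarrow> (complex \<Rightarrow> complex) \<Rightarrow> (complex \<Rightarrow> complex) set" where
  "to_ab K \<sigma> = carrier (\<Gamma> (max_abelian_extension K)) #>\<^bsub>\<Gamma> K\<^esub> \<sigma>"


section \<open>CM fields and CM types\<close>

definition totally_real :: "complex set \<Rightarrow> bool" where
  "totally_real L \<longleftrightarrow> number_field L \<and> (\<forall>\<rho>\<in>embs L. \<rho> ` L \<subseteq> \<real>)"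

definition totally_imaginary :: "complex set \<Rightarrow> bool" where
  "totally_imaginary L \<longleftrightarrow> number_field L \<and> (\<forall>\<rho>\<in>embs L. \<not> \<rho> ` L \<subseteq> \<real>)"

definition CM_field :: "complex set \<Rightarrow> bool" where
  "CM_field K \<longleftrightarrow> totally_imaginary K \<and>
     (\<exists>L. totally_real L \<and> L \<subseteq> K \<and> ring.dimension CC 2 L K)"

definition max_totally_real_subfield :: "complex set \<Rightarrow> complex set \<Rightarrow> bool" where
  "max_totally_real_subfield F K \<longleftrightarrow>
     totally_real F \<and> F \<subseteq> K \<and> (\<forall>L. totally_real L \<and> L \<subseteq> K \<longrightarrow> L \<subseteq> F)"

definition conj_emb :: "complex set \<Rightarrow> (complex \<Rightarrow> complex) \<Rightarrow> complex \<Rightarrow> complex" where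
  "conj_emb K \<rho> = compose K conj_Q \<rho>"

definition CM_type :: "complex set \<Rightarrow> (complex \<Rightarrow> complex) set \<Rightarrow> bool" where
  "CM_type K \<Phi> \<longleftrightarrow>
     \<Phi> \<subseteq> embs K \<and> \<Phi> \<inter> conj_emb K ` \<Phi> = {} \<and> \<Phi> \<union> conj_emb K ` \<Phi> = embs K"


section \<open>Plectic groups\<close>

text \<open>The group \<open>G#H\<close>, for a subgroup \<open>H\<close> of \<open>G\<close> (of finite index in all uses below).\<close>

definition plectic :: "('a, 'b) monoid_scheme \<Rightarrow> 'a set \<Rightarrow> ('a \<Rightarrow> 'a) monoid" where
  "plectic G H = (BijGroup (carrier G))\<lparr>carrier :=
     {\<alpha> \<in> Bij (carrier G). \<forall>g\<in>carrier G. \<forall>h\<in>H. \<alpha> (g \<otimes>\<^bsub>G\<^esub> h) = \<alpha> g \<otimes>\<^bsub>G\<^esub> h}\<rparr>"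

text \<open>
  The left coset of \<open>carrier (\<Gamma> L)\<close> in \<open>\<Gamma>Q\<close> that is identified with \<open>\<rho> \<in> embs L\<close>.
\<close>

definition lifts :: "complex set \<Rightarrow> (complex \<Rightarrow> complex) \<Rightarrow> (complex \<Rightarrow> complex) set" where
  "lifts L \<rho> = {\<sigma> \<in> carrier \<Gamma>Q. restrict \<sigma> L = \<rho>}"

text \<open>The permutation of \<open>embs L\<close> induced by an element of \<open>plectic \<Gamma>Q (carrier (\<Gamma> L))\<close>.\<close>

definition plectic_act ::
  "complex set \<Rightarrow> ((complex \<Rightarrow> complex) \<Rightarrow> complex \<Rightarrow> complex) \<Rightarrow>
   (complex \<Rightarrow> complex) \<Rightarrow> complex \<Rightarrow> complex" where
  "plectic_act L \<alpha> \<rho> = the_elem ((\<lambda>\<sigma>. restrict (\<alpha> \<sigma>) L) ` lifts L \<rho>)"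

definition coset_reps ::
  "complex set \<Rightarrow> ((complex \<Rightarrow> complex) \<Rightarrow> complex \<Rightarrow> complex) \<Rightarrow> bool" where
  "coset_reps L s \<longleftrightarrow> (\<forall>\<rho>\<in>embs L. s \<rho> \<in> lifts L \<rho>)"


section \<open>The tensor product over the rationals\<close>

text \<open>
  The free abelian group on \<open>A \<times> B\<close>, with the biadditive multiplication extending
  \<open>(a, b) (a', b') = (a a', b b')\<close>.
\<close>

definition free_pairs :: "complex set \<Rightarrow> complex set \<Rightarrow> ((complex \<times> complex) \<Rightarrow>\<^sub>0 int) ring" where
  "free_pairs A B = \<lparr>carrier = {f. Poly_Mapping.keys f \<subseteq> A \<times> B},
     monoid.mult = (\<lambda>f f'. frag_extend (\<lambda>p. frag_extend
       (\<lambda>q. frag_of (fst p * fst q, snd p * snd q)) f') f),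
     one = frag_of (1, 1), ring.zero = 0, add = (+)\<rparr>"

definition tensor_relations ::
  "complex set \<Rightarrow> complex set \<Rightarrow> ((complex \<times> complex) \<Rightarrow>\<^sub>0 int) set" where
  "tensor_relations A B =
     {frag_of (a + a', b) - frag_of (a, b) - frag_of (a', b) | a a' b.
        a \<in> A \<and> a' \<in> A \<and> b \<in> B} \<union>
     {frag_of (a, b + b') - frag_of (a, b) - frag_of (a, b') | a b b'.
        a \<in> A \<and> b \<in> B \<and> b' \<in> B} \<union>
     {frag_of (q * a, b) - frag_of (a, q * b) | q a b.
        q \<in> \<rat> \<and> a \<in> A \<and> b \<in> B}"

text \<open>
  For subfields \<open>A\<close> and \<open>B\<close>, the additive subgroup generated by the relations is stable under
  multiplication by pure tensors, so the ideal generated by them is the usual group of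
  relations and the quotient ring is \<open>A \<otimes>\<^sub>\<rat> B\<close>.
\<close>

definition tensor_ideal ::
  "complex set \<Rightarrow> complex set \<Rightarrow> ((complex \<times> complex) \<Rightarrow>\<^sub>0 int) set" where
  "tensor_ideal A B = genideal (free_pairs A B) (tensor_relations A B)"

definition tensor :: "complex set \<Rightarrow> complex set \<Rightarrow> ((complex \<times> complex) \<Rightarrow>\<^sub>0 int) set ring" where
  "tensor A B = free_pairs A B Quot tensor_ideal A B"

definition pure_tensor ::
  "complex set \<Rightarrow> complex set \<Rightarrow> complex \<Rightarrow> complex \<Rightarrow> ((complex \<times> complex) \<Rightarrow>\<^sub>0 int) set" where
  "pure_tensor A B a b = tensor_ideal A B +>\<^bsub>free_pairs A B\<^esub> frag_of (a, b)"

text \<open>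
  \<open>F\<close>-algebra automorphisms of \<open>F \<otimes>\<^sub>\<rat> Qbar\<close>; a ring endomorphism is \<open>F\<close>-linear iff it fixes
  every \<open>a \<otimes> 1\<close>.
\<close>

definition F_auts ::
  "complex set \<Rightarrow> (((complex \<times> complex) \<Rightarrow>\<^sub>0 int) set \<Rightarrow> ((complex \<times> complex) \<Rightarrow>\<^sub>0 int) set) set"
  where
  "F_auts F = {g \<in> Bij (carrier (tensor F Qbar)).
     g \<in> ring_hom (tensor F Qbar) (tensor F Qbar) \<and>
     (\<forall>a\<in>F. g (pure_tensor F Qbar a 1) = pure_tensor F Qbar a 1)}"

text \<open>
  The coordinate at \<open>x \<in> embs F\<close> of the identification
  \<open>F \<otimes>\<^sub>\<rat> Qbar \<cong> \<Prod>\<^sub>x Qbar\<close>, \<open>a \<otimes> b \<mapsto> (x(a) b)\<^sub>x\<close>: an element of the tensor product is a coset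
  of formal sums, on which the additive extension of \<open>(a, b) \<mapsto> x(a) b\<close> is constant.
\<close>

definition tensor_coord ::
  "((complex \<times> complex) \<Rightarrow>\<^sub>0 int) set \<Rightarrow> (complex \<Rightarrow> complex) \<Rightarrow> complex" where
  "tensor_coord t x = the_elem ((\<lambda>f. \<Sum>p\<in>Poly_Mapping.keys f.
     of_int (Poly_Mapping.lookup f p) * (x (fst p) * snd p)) ` t)"


section \<open>The canonical isomorphism\<close>

type_synonym coords =
  "((complex \<Rightarrow> complex) \<Rightarrow> complex \<Rightarrow> complex) \<times> ((complex \<Rightarrow> complex) \<Rightarrow> complex \<Rightarrow> complex)"

text \<open>
  \<open>beta F s g\<close> and \<open>rho F s \<alpha>\<close> are the underlying pairs \<open>(\<pi>, (h\<^sub>x)\<^sub>x)\<close> of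
  the elements \<open>\<beta>\<^sub>s(g)\<close> and \<open>\<rho>\<^sub>s(\<alpha>)\<close> of the semidirect product of \<open>S\<^sub>X\<close> and
  \<open>\<Gamma>\<^sub>F\<^sup>X\<close>, where \<open>X = embs F\<close>.
\<close>

definition beta ::
  "complex set \<Rightarrow> ((complex \<Rightarrow> complex) \<Rightarrow> complex \<Rightarrow> complex) \<Rightarrow>
   (((complex \<times> complex) \<Rightarrow>\<^sub>0 int) set \<Rightarrow> ((complex \<times> complex) \<Rightarrow>\<^sub>0 int) set) \<Rightarrow> coords" where
  "beta F s g = (THE (\<pi>, h).
     \<pi> \<in> Bij (embs F) \<and> h \<in> embs F \<rightarrow>\<^sub>E carrier (\<Gamma> F) \<and>
     (\<forall>t\<in>carrier (tensor F Qbar). \<forall>a\<in>embs F \<rightarrow>\<^sub>E Qbar. \<forall>b\<in>embs F \<rightarrow>\<^sub>E Qbar.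
        (\<forall>x\<in>embs F. tensor_coord t x = s x (a x)) \<longrightarrow>
        (\<forall>x\<in>embs F. tensor_coord (g t) x = s x (b x)) \<longrightarrow>
        (\<forall>x\<in>embs F. b (\<pi> x) = h x (a x))))"

definition rho ::
  "complex set \<Rightarrow> ((complex \<Rightarrow> complex) \<Rightarrow> complex \<Rightarrow> complex) \<Rightarrow>
   ((complex \<Rightarrow> complex) \<Rightarrow> complex \<Rightarrow> complex) \<Rightarrow> coords" where
  "rho F s \<alpha> =
     (\<lambda>x\<in>embs F. plectic_act F \<alpha> x,
      \<lambda>x\<in>embs F. inv\<^bsub>\<Gamma>Q\<^esub> (s (plectic_act F \<alpha> x)) \<otimes>\<^bsub>\<Gamma>Q\<^esub> \<alpha> (s x))"

definition canonical_iso ::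
  "complex set \<Rightarrow> ((complex \<Rightarrow> complex) \<Rightarrow> complex \<Rightarrow> complex) \<Rightarrow>
   (((complex \<times> complex) \<Rightarrow>\<^sub>0 int) set \<Rightarrow> ((complex \<times> complex) \<Rightarrow>\<^sub>0 int) set) \<Rightarrow>
   (complex \<Rightarrow> complex) \<Rightarrow> complex \<Rightarrow> complex" where
  "canonical_iso F s g =
     inv_into (carrier (plectic \<Gamma>Q (carrier (\<Gamma> F)))) (rho F s) (beta F s g)"


section \<open>The half-transfer map\<close>

definition CM_exponents ::
  "complex set \<Rightarrow> complex set \<Rightarrow> (complex \<Rightarrow> complex) set \<Rightarrow>
   ((complex \<Rightarrow> complex) \<Rightarrow> complex \<Rightarrow> complex) \<Rightarrow> (complex \<Rightarrow> complex) \<Rightarrow> bit" where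
  "CM_exponents K F \<Phi> s = (THE a. a \<in> extensional (embs F) \<and>
     \<Phi> = {restrict (conj_pow (a x) \<otimes>\<^bsub>\<Gamma>Q\<^esub> s x) K | x. x \<in> embs F})"

definition conj_exponent :: "complex set \<Rightarrow> (complex \<Rightarrow> complex) \<Rightarrow> bit" where
  "conj_exponent K h = (THE e. restrict h K = restrict (conj_pow e) K)"

text \<open>Nekovar's half-transfer map, computed with the coset representatives \<open>s\<close>.\<close>

definition half_transfer ::
  "complex set \<Rightarrow> complex set \<Rightarrow> (complex \<Rightarrow> complex) set \<Rightarrow>
   ((complex \<Rightarrow> complex) \<Rightarrow> complex \<Rightarrow> complex) \<Rightarrow>
   (((complex \<times> complex) \<Rightarrow>\<^sub>0 int) set \<Rightarrow> ((complex \<times> complex) \<Rightarrow>\<^sub>0 int) set) \<Rightarrow>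
   (complex \<Rightarrow> complex) set" where
  "half_transfer K F \<Phi> s g =
     (let (\<pi>, h) = beta F s g; a = CM_exponents K F \<Phi> s in
      \<Otimes>\<^bsub>\<Gamma>_ab K\<^esub>x\<in>embs F. to_ab K
        (inv\<^bsub>\<Gamma>Q\<^esub> (s (\<pi> x)) \<otimes>\<^bsub>\<Gamma>Q\<^esub> conj_pow (a x + conj_exponent K (h x)) \<otimes>\<^bsub>\<Gamma>Q\<^esub> s (\<pi> x)
          \<otimes>\<^bsub>\<Gamma>Q\<^esub> h x \<otimes>\<^bsub>\<Gamma>Q\<^esub> inv\<^bsub>\<Gamma>Q\<^esub> (s x) \<otimes>\<^bsub>\<Gamma>Q\<^esub> conj_pow (a x) \<otimes>\<^bsub>\<Gamma>Q\<^esub> s x))"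

end

theory Submission
  imports Defs
begin

text \<open>
  Let \<open>X\<close> be the set of embeddings of \<open>F\<close>. For \<open>x\<close> in \<open>X\<close>, composing \<open>g\<close> with the coordinate
  at \<open>x\<close> gives a ring homomorphism on \<open>F \<otimes> Qbar\<close> that is \<open>x\<close> on \<open>F\<close> and some \<open>\<sigma>\<close> in \<open>\<Gamma>Q\<close> on
  \<open>Qbar\<close>; hence it equals \<open>\<sigma>\<close> after the coordinate at the restriction of \<open>\<sigma>\<^sup>-\<^sup>1 x\<close>. This determines the
  permutation \<open>\<pi>\<close> and shows that \<open>\<alpha>\<close> maps \<open>u\<close> to \<open>\<sigma> u\<close>, where \<open>\<sigma>\<close> belongs to \<open>\<pi> (u|F)\<close>. Pure
  tensors suffice to see that \<open>(\<pi>, h)\<close> is unique, so the bijectivity of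
  \<open>F \<otimes> Qbar \<rightarrow> Qbar\<^sup>X\<close> is never needed.

  Put \<open>k x = s(x)\<^sup>-\<^sup>1 w(s(x)|K)\<close> in \<open>\<Gamma> K\<close>. Since \<open>w\<close> commutes with complex conjugation,
  \<open>w(c\<^sup>e s(x)|K) = c\<^sup>e s(x) k(x)\<close>, so the factor of the right-hand side at the element of \<open>\<Phi>\<close> above
  \<open>x\<close> is \<open>k(\<pi> x)\<^sup>-\<^sup>1\<close> times Nekovar's factor times \<open>k(x)\<close>. In the abelianized group the
  \<open>k\<close> cancel in the product over \<open>x\<close> because \<open>\<pi>\<close> is a permutation.
\<close>

section \<open>Algebraic numbers and embeddings\<close>

lemma field_CC: "field CC"
  by (rule field_from_type_algebra)

interpretation CC: domain CC
  using field_CC by (rule field.axioms)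

lemma CC_simps [simp]:
  "carrier CC = UNIV" "x \<otimes>\<^bsub>CC\<^esub> y = x * y" "\<one>\<^bsub>CC\<^esub> = 1" "\<zero>\<^bsub>CC\<^esub> = 0" "x \<oplus>\<^bsub>CC\<^esub> y = x + y"
  by (simp_all add: ring_of_type_algebra_def)

lemma CC_a_inv [simp]: "\<ominus>\<^bsub>CC\<^esub> x = - x"
  by (metis CC.minus_equality CC_simps(1,4,5) UNIV_I add.left_inverse)

lemma CC_m_inv [simp]: "x \<noteq> 0 \<Longrightarrow> inv\<^bsub>CC\<^esub> x = inverse x"
  by (metis CC.comm_inv_char CC_simps(1,2,3) UNIV_I right_inverse)

lemma CC_pow [simp]: "x [^]\<^bsub>CC\<^esub> (n::nat) = x ^ n"
  by (induction n) (simp_all add: mult.commute)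

text \<open>Polynomials of HOL-Algebra are lists with the leading coefficient first, so the list is
  reversed before it is passed to \<open>Poly\<close>.\<close>

lemma CC_eval: "CC.eval p x = poly (Poly (rev p)) x"
  by (induction p) (simp_all add: Poly_append poly_monom)

lemma subfield_CC_iff:
  "subfield L CC \<longleftrightarrow> 0 \<in> L \<and> 1 \<in> L \<and> (\<forall>x\<in>L. \<forall>y\<in>L. x + y \<in> L \<and> x * y \<in> L) \<and>
     (\<forall>x\<in>L. - x \<in> L \<and> inverse x \<in> L)"
proof
  assume L: "subfield L CC"
  have sr: "subring L CC" using L by (rule subfieldE)
  have "inverse x \<in> L" if "x \<in> L" for x
  proof (cases "x = 0")
    case False
    then show ?thesis using CC.subfield_m_inv(1)[OF L, of x] that by auto
  qed (use subringE(2)[OF sr] in auto)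
  then show "0 \<in> L \<and> 1 \<in> L \<and> (\<forall>x\<in>L. \<forall>y\<in>L. x + y \<in> L \<and> x * y \<in> L) \<and>
     (\<forall>x\<in>L. - x \<in> L \<and> inverse x \<in> L)"
    using subringE(2,3,5,6,7)[OF sr] by auto
next
  assume *: "0 \<in> L \<and> 1 \<in> L \<and> (\<forall>x\<in>L. \<forall>y\<in>L. x + y \<in> L \<and> x * y \<in> L) \<and>
     (\<forall>x\<in>L. - x \<in> L \<and> inverse x \<in> L)"
  have "subring L CC"
    by (rule CC.subringI) (use * in auto)
  then show "subfield L CC"
    by (rule field.subfieldI'[OF field_CC]) (use * in auto)
qed

lemma subfield_CC_simps:
  assumes "subfield L CC"
  shows "0 \<in> L" "1 \<in> L" "x \<in> L \<Longrightarrow> y \<in> L \<Longrightarrow> x + y \<in> L" "x \<in> L \<Longrightarrow> y \<in> L \<Longrightarrow> x * y \<in> L"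
    "x \<in> L \<Longrightarrow> y \<in> L \<Longrightarrow> x - y \<in> L" "x \<in> L \<Longrightarrow> y \<in> L \<Longrightarrow> x / y \<in> L" "x \<in> L \<Longrightarrow> inverse x \<in> L"
  using assms by (auto simp: subfield_CC_iff divide_inverse) (metis diff_conv_add_uminus)

lemma subfield_CC_Rats: "subfield \<rat> CC"
  by (auto simp: subfield_CC_iff)

lemma Rats_subset_subfield:
  assumes "subfield L CC"
  shows "\<rat> \<subseteq> L"
proof
  fix x :: complex assume "x \<in> \<rat>"
  then obtain a b :: int where x: "x = of_int a / of_int b" by (auto elim: Rats_cases')
  have nat: "of_nat n \<in> L" for n
    using assms by (induction n) (auto simp: subfield_CC_iff)
  have int: "of_int n \<in> L" for n
    by (cases n rule: int_cases2) (use assms nat in \<open>auto simp: subfield_CC_iff\<close>)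
  show "x \<in> L"
    using int[of a] int[of b] assms by (auto simp: x subfield_CC_iff divide_inverse)
qed

text \<open>Links algebraicity over the subfield \<open>\<rat>\<close> of \<open>CC\<close> with the
  predicate that defines \<open>Qbar\<close>. General facts on field extensions (algebraic elements
  form a subfield, finite extensions are algebraic) then apply to \<open>Qbar\<close>.\<close>

lemma algebraic_over_Rats_iff: "(CC.algebraic over \<rat>) x \<longleftrightarrow> algebraic x"
proof
  assume "(CC.algebraic over \<rat>) x"
  then obtain p where p: "p \<in> carrier (univ_poly CC \<rat>)" "p \<noteq> []" "CC.eval p x = \<zero>\<^bsub>CC\<^esub>"
    using CC.algebraicE[OF subfieldE(1)[OF subfield_CC_Rats]] by auto
  from p have set: "set p \<subseteq> \<rat>" and hd: "hd p \<noteq> 0"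
    by (auto simp: univ_poly_carrier[symmetric] polynomial_def)
  show "algebraic x"
  proof (rule algebraicI')
    show "Polynomial.coeff (Poly (rev p)) i \<in> \<rat>" for i
      using set nth_mem[of i "rev p"] by (auto simp: nth_default_def)
    show "Poly (rev p) \<noteq> 0"
    proof
      assume "Poly (rev p) = 0"
      then obtain n where n: "rev p = replicate n 0" by (auto simp: Poly_eq_0)
      have "set p = set (replicate n (0::complex))" unfolding n[symmetric] by simp
      then show False
        using hd p(2) hd_in_set[of p] by (auto split: if_splits)
    qed
    show "poly (Poly (rev p)) x = 0"
      using p(3) by (simp add: CC_eval)
  qed
next
  assume "algebraic x"
  then obtain p where p: "\<And>i. Polynomial.coeff p i \<in> \<rat>" "p \<noteq> 0" "poly p x = 0"
    by (auto simp: algebraic_altdef)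
  show "(CC.algebraic over \<rat>) x"
  proof (rule CC.algebraicI)
    show "rev (coeffs p) \<in> carrier (univ_poly CC \<rat>)"
      using p(1,2) last_coeffs_eq_coeff_degree[of p]
      by (auto simp: univ_poly_carrier[symmetric] polynomial_def hd_rev range_coeff[symmetric] coeffs_def)
    show "CC.eval (rev (coeffs p)) x = \<zero>\<^bsub>CC\<^esub>"
      using p(3) by (simp add: CC_eval)
  qed (use p(2) in auto)
qed

lemma subfield_CC_Qbar: "subfield Qbar CC"
  using field.subfield_of_algebraics[OF field_CC subfield_CC_Rats]
  by (simp add: algebraic_over_Rats_iff Qbar_def)

lemma number_field_subset_Qbar:
  assumes "number_field L"
  shows "L \<subseteq> Qbar"
proof
  fix x assume "x \<in> L"
  then have "(CC.algebraic over \<rat>) x"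
    using CC.finite_dimension_imp_algebraic[OF subfield_CC_Rats, of L] assms \<open>x \<in> L\<close>
    by (auto simp: number_field_def dest: subfieldE(1))
  then show "x \<in> Qbar" by (simp add: algebraic_over_Rats_iff Qbar_def)
qed

lemma Qbar_closed [simp]:
  "0 \<in> Qbar" "1 \<in> Qbar" "x \<in> Qbar \<Longrightarrow> y \<in> Qbar \<Longrightarrow> x + y \<in> Qbar"
  "x \<in> Qbar \<Longrightarrow> y \<in> Qbar \<Longrightarrow> x * y \<in> Qbar" "x \<in> Qbar \<Longrightarrow> cnj x \<in> Qbar"
  using subfield_CC_Qbar by (auto simp: subfield_CC_iff Qbar_def)


section \<open>Embeddings of subfields into the algebraic numbers\<close>

lemma embs_iff:
  "\<rho> \<in> embs L \<longleftrightarrow> \<rho> \<in> extensional L \<and> (\<forall>z\<in>L. \<rho> z \<in> Qbar) \<and> \<rho> 1 = 1 \<and>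
     (\<forall>x\<in>L. \<forall>y\<in>L. \<rho> (x + y) = \<rho> x + \<rho> y \<and> \<rho> (x * y) = \<rho> x * \<rho> y)"
  by (auto simp: embs_def ring_hom_def)

context
  fixes L \<rho>
  assumes L: "subfield L CC" and \<rho>: "\<rho> \<in> embs L"
begin

lemma embs_simps:
  "\<rho> 1 = 1" "x \<in> L \<Longrightarrow> y \<in> L \<Longrightarrow> \<rho> (x + y) = \<rho> x + \<rho> y"
  "x \<in> L \<Longrightarrow> y \<in> L \<Longrightarrow> \<rho> (x * y) = \<rho> x * \<rho> y" "x \<in> L \<Longrightarrow> \<rho> x \<in> Qbar"
  using \<rho> by (auto simp: embs_iff)

lemma embs_zero: "\<rho> 0 = 0"
  using embs_simps(2)[of 0 0] L by (simp add: subfield_CC_iff)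

lemma embs_minus: "x \<in> L \<Longrightarrow> \<rho> (- x) = - \<rho> x"
  using embs_simps(2)[of x "- x"] L embs_zero by (simp add: subfield_CC_iff minus_unique)

lemma embs_inverse: "x \<in> L \<Longrightarrow> \<rho> (inverse x) = inverse (\<rho> x)"
  using embs_simps(1) embs_simps(3)[of x "inverse x"] L embs_zero
  by (cases "x = 0") (simp_all add: subfield_CC_iff inverse_unique[symmetric])

lemma embs_inj_on: "inj_on \<rho> L"
proof (rule inj_onI)
  fix x y assume xy: "x \<in> L" "y \<in> L" "\<rho> x = \<rho> y"
  have d: "x - y \<in> L" using L xy by (metis diff_conv_add_uminus subfield_CC_iff)
  have "\<rho> (x - y) = 0"
    using xy embs_simps(2)[of x "- y"] L embs_minus[of y] by (simp add: subfield_CC_iff)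
  then show "x = y"
    using embs_simps(3)[of "x - y" "inverse (x - y)"] embs_simps(1) L d
    by (cases "x = y") (auto simp: subfield_CC_iff)
qed

lemma embs_Rats: "q \<in> \<rat> \<Longrightarrow> \<rho> q = q"
proof -
  assume "q \<in> \<rat>"
  then obtain a b :: int where q: "q = of_int a / of_int b" by (auto elim: Rats_cases')
  have LQ: "\<rat> \<subseteq> L" using L by (rule Rats_subset_subfield)
  have nat: "\<rho> (of_nat n) = of_nat n" for n
  proof (induction n)
    case (Suc n)
    have "of_nat n \<in> L" "1 \<in> L" using LQ Rats_of_nat Rats_1 by blast+
    then show ?case using embs_simps(1,2) Suc by simp
  qed (simp add: embs_zero)
  have int: "\<rho> (of_int n) = of_int n" for n
    by (cases n rule: int_cases2) (use nat embs_minus subsetD[OF LQ Rats_of_nat] in auto)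
  have "of_int a \<in> L" "of_int b \<in> L" "inverse (of_int b) \<in> L"
    using LQ Rats_of_int L by (auto simp: subfield_CC_iff)
  then show ?thesis by (simp add: q divide_inverse embs_simps embs_inverse int)
qed

end

lemma embs_compose:
  assumes "\<rho> \<in> embs L" "\<sigma> \<in> embs Qbar" "subfield L CC"
  shows "compose L \<sigma> \<rho> \<in> embs L"
  unfolding embs_iff
proof (intro conjI ballI)
  fix x y assume "x \<in> L" "y \<in> L"
  moreover from this have "x + y \<in> L" "x * y \<in> L" using assms(3) by (auto simp: subfield_CC_iff)
  ultimately show "compose L \<sigma> \<rho> (x + y) = compose L \<sigma> \<rho> x + compose L \<sigma> \<rho> y"
    "compose L \<sigma> \<rho> (x * y) = compose L \<sigma> \<rho> x * compose L \<sigma> \<rho> y"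
    using assms by (auto simp: embs_iff compose_eq)
qed (use assms in \<open>auto simp: embs_iff compose_def subfield_CC_iff\<close>)

lemma embs_restrict:
  assumes "\<rho> \<in> embs M" "subfield L CC" "L \<subseteq> M"
  shows "restrict \<rho> L \<in> embs L"
  using assms by (auto simp: embs_iff subfield_CC_iff subset_iff)

lemma conj_Q_embs: "conj_Q \<in> embs Qbar"
  by (auto simp: embs_iff conj_Q_def)

section \<open>Galois groups over the rationals\<close>

lemma \<Gamma>_iff:
  "\<sigma> \<in> carrier (\<Gamma> L) \<longleftrightarrow> \<sigma> \<in> embs Qbar \<and> bij_betw \<sigma> Qbar Qbar \<and> (\<forall>z\<in>L. \<sigma> z = z)"
  by (auto simp: \<Gamma>_def Gal_def embs_def Bij_def)

text \<open>Every algebraic number is a root of some nonzero integer polynomial. An embedding maps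
  the finite set of roots injectively into itself, hence onto itself, so it is surjective.\<close>

lemma embs_Qbar_bij:
  assumes "\<sigma> \<in> embs Qbar"
  shows "bij_betw \<sigma> Qbar Qbar"
proof -
  note \<sigma> = embs_simps[OF subfield_CC_Qbar assms] embs_zero[OF subfield_CC_Qbar assms]
    embs_Rats[OF subfield_CC_Qbar assms]
  have inj: "inj_on \<sigma> Qbar" by (rule embs_inj_on[OF subfield_CC_Qbar assms])
  have "z \<in> \<sigma> ` Qbar" if z: "z \<in> Qbar" for z
  proof -
    from z obtain p where p: "\<And>i. Polynomial.coeff p i \<in> \<int>" "p \<noteq> 0" "poly p z = 0"
      by (auto simp: Qbar_def algebraic_def)
    define R where "R = {y. poly p y = 0}"
    have fin: "finite R" using p(2) unfolding R_def by (rule poly_roots_finite)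
    have RQ: "R \<subseteq> Qbar" using p by (auto simp: R_def Qbar_def intro: algebraicI)
    \<comment> \<open>Integers are fixed by \<open>\<sigma>\<close>, so it commutes with the
      evaluation of integer polynomials and sends roots to roots.\<close>
    have poly: "poly q y \<in> Qbar \<and> \<sigma> (poly q y) = poly q (\<sigma> y)"
      if "y \<in> Qbar" "\<And>i. Polynomial.coeff q i \<in> \<int>" for q y
      using that(2)
    proof (induction q)
      case (pCons a q)
      have "Polynomial.coeff q i \<in> \<int>" for i using pCons.prems[of "Suc i"] by simp
      then have IH: "poly q y \<in> Qbar" "\<sigma> (poly q y) = poly q (\<sigma> y)" using pCons.IH by auto
      have "a \<in> \<int>" using pCons.prems[of 0] by simp
      then have a: "a \<in> \<rat>" by (auto elim: Ints_cases)
      then have "a \<in> Qbar" using Rats_subset_subfield[OF subfield_CC_Qbar] by auto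
      then show ?case using IH that(1) \<sigma>(6)[OF a] by (simp add: \<sigma>)
    qed (simp add: \<sigma>)
    have "\<sigma> ` R \<subseteq> R"
      using poly p(1) RQ \<sigma>(5) by (force simp: R_def)
    then have "\<sigma> ` R = R"
      using fin inj_on_subset[OF inj RQ] by (simp add: endo_inj_surj)
    then show ?thesis using p(3) RQ by (auto simp: R_def)
  qed
  then show ?thesis using inj \<sigma>(4) by (auto simp: bij_betw_def)
qed

text \<open>Bijectivity is automatic by the root argument, and rational numbers are fixed by every
  embedding. Membership in \<open>\<Gamma>Q\<close> thus reduces to the homomorphism laws.\<close>

lemma \<Gamma>Q_iff_embs: "\<sigma> \<in> carrier \<Gamma>Q \<longleftrightarrow> \<sigma> \<in> embs Qbar"
  using embs_Qbar_bij embs_Rats[OF subfield_CC_Qbar] by (auto simp: \<Gamma>_iff)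

lemma \<Gamma>_iff_fixes: "\<sigma> \<in> carrier (\<Gamma> L) \<longleftrightarrow> \<sigma> \<in> carrier \<Gamma>Q \<and> (\<forall>z\<in>L. \<sigma> z = z)"
  using embs_Qbar_bij embs_Rats[OF subfield_CC_Qbar] by (auto simp: \<Gamma>Q_iff_embs \<Gamma>_iff)

lemma carrier_\<Gamma>_subset: "carrier (\<Gamma> L) \<subseteq> carrier \<Gamma>Q"
  by (auto simp: \<Gamma>_iff_fixes[of _ L])

lemma \<Gamma>_antimono:
  assumes "L \<subseteq> M"
  shows "carrier (\<Gamma> M) \<subseteq> carrier (\<Gamma> L)"
proof
  fix \<sigma> assume "\<sigma> \<in> carrier (\<Gamma> M)"
  then show "\<sigma> \<in> carrier (\<Gamma> L)"
    unfolding \<Gamma>_iff_fixes[of \<sigma> M] \<Gamma>_iff_fixes[of \<sigma> L] using assms by blast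
qed

text \<open>The groups \<open>\<Gamma> L\<close> share one multiplication and differ only in their
  carrier, so computations can take place in \<open>\<Gamma>Q\<close>.\<close>

lemma \<Gamma>_eq: "\<Gamma> L = \<Gamma>Q\<lparr>carrier := carrier (\<Gamma> L)\<rparr>"
  by (simp add: \<Gamma>_def Gal_def)

lemma \<Gamma>Q_mult:
  assumes "\<sigma> \<in> carrier \<Gamma>Q" "\<tau> \<in> carrier \<Gamma>Q"
  shows "\<sigma> \<otimes>\<^bsub>\<Gamma>Q\<^esub> \<tau> = compose Qbar \<sigma> \<tau>"
  using assms by (simp add: \<Gamma>_def Gal_def BijGroup_def)

lemma \<Gamma>Q_one: "\<one>\<^bsub>\<Gamma>Q\<^esub> = (\<lambda>z\<in>Qbar. z)"
  by (simp add: \<Gamma>_def Gal_def BijGroup_def)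

lemma \<Gamma>Q_mult_apply [simp]:
  assumes "\<sigma> \<in> carrier \<Gamma>Q" "\<tau> \<in> carrier \<Gamma>Q" "z \<in> Qbar"
  shows "(\<sigma> \<otimes>\<^bsub>\<Gamma>Q\<^esub> \<tau>) z = \<sigma> (\<tau> z)"
  using assms by (simp add: \<Gamma>Q_mult compose_eq)

lemma \<Gamma>Q_one_apply [simp]: "z \<in> Qbar \<Longrightarrow> \<one>\<^bsub>\<Gamma>Q\<^esub> z = z"
  by (simp add: \<Gamma>Q_one)

lemma \<Gamma>Q_closed [simp]: "\<sigma> \<in> carrier \<Gamma>Q \<Longrightarrow> z \<in> Qbar \<Longrightarrow> \<sigma> z \<in> Qbar"
  by (auto simp: \<Gamma>Q_iff_embs embs_iff)

lemma \<Gamma>Q_eqI: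
  assumes "\<sigma> \<in> carrier \<Gamma>Q" "\<tau> \<in> carrier \<Gamma>Q" "\<And>z. z \<in> Qbar \<Longrightarrow> \<sigma> z = \<tau> z"
  shows "\<sigma> = \<tau>"
  using assms by (auto simp: \<Gamma>Q_iff_embs embs_iff intro: extensionalityI)

interpretation \<Gamma>Q: group \<Gamma>Q
proof (rule groupI)
  fix \<sigma> assume \<sigma>: "\<sigma> \<in> carrier \<Gamma>Q"
  then have bij: "bij_betw \<sigma> Qbar Qbar" by (auto simp: \<Gamma>_iff)
  define \<tau> where "\<tau> = restrict (inv_into Qbar \<sigma>) Qbar"
  have inv: "\<tau> z \<in> Qbar \<and> \<sigma> (\<tau> z) = z" "\<tau> (\<sigma> z) = z" if "z \<in> Qbar" for z
    using that bij \<sigma> bij_betw_inv_into_left[OF bij] bij_betw_inv_into_right[OF bij]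
      inv_into_into[of z \<sigma> Qbar]
    by (auto simp: \<tau>_def bij_betw_def)
  have "\<tau> \<in> embs Qbar"
    unfolding embs_iff
  proof (intro conjI ballI)
    note \<sigma>' = embs_simps[OF subfield_CC_Qbar, of \<sigma>]
    have e: "\<sigma> \<in> embs Qbar" using \<sigma> by (simp add: \<Gamma>Q_iff_embs)
    show "\<tau> 1 = 1" using inv(2)[of 1] \<sigma>'(1)[OF e] by simp
    fix x y assume xy: "x \<in> Qbar" "y \<in> Qbar"
    have "x + y = \<sigma> (\<tau> x + \<tau> y)" "x * y = \<sigma> (\<tau> x * \<tau> y)"
      using \<sigma>'(2,3)[OF e] inv(1) xy by auto
    then show "\<tau> (x + y) = \<tau> x + \<tau> y" "\<tau> (x * y) = \<tau> x * \<tau> y"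
      using inv xy by (metis Qbar_closed(3), metis Qbar_closed(4))
  qed (use inv in \<open>auto simp: \<tau>_def\<close>)
  then have "\<tau> \<in> carrier \<Gamma>Q" by (simp add: \<Gamma>Q_iff_embs)
  moreover have "\<tau> \<otimes>\<^bsub>\<Gamma>Q\<^esub> \<sigma> = \<one>\<^bsub>\<Gamma>Q\<^esub>"
    unfolding \<Gamma>Q_mult[OF \<open>\<tau> \<in> carrier \<Gamma>Q\<close> \<sigma>] \<Gamma>Q_one
    by (rule ext) (auto simp: compose_def inv)
  ultimately show "\<exists>\<tau>\<in>carrier \<Gamma>Q. \<tau> \<otimes>\<^bsub>\<Gamma>Q\<^esub> \<sigma> = \<one>\<^bsub>\<Gamma>Q\<^esub>" by blast
next
  have *: "\<sigma> \<otimes>\<^bsub>\<Gamma>Q\<^esub> \<tau> \<in> carrier \<Gamma>Q" if "\<sigma> \<in> carrier \<Gamma>Q" "\<tau> \<in> carrier \<Gamma>Q" for \<sigma> \<tau>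
    using that by (simp add: \<Gamma>Q_mult) (simp add: \<Gamma>Q_iff_embs embs_compose subfield_CC_Qbar)
  then show "\<And>\<sigma> \<tau>. \<sigma> \<in> carrier \<Gamma>Q \<Longrightarrow> \<tau> \<in> carrier \<Gamma>Q \<Longrightarrow> \<sigma> \<otimes>\<^bsub>\<Gamma>Q\<^esub> \<tau> \<in> carrier \<Gamma>Q" .
  show one: "\<one>\<^bsub>\<Gamma>Q\<^esub> \<in> carrier \<Gamma>Q"
    unfolding \<Gamma>Q_iff_embs by (auto simp: embs_iff \<Gamma>Q_one)
  fix \<sigma> \<tau> \<upsilon> assume s: "\<sigma> \<in> carrier \<Gamma>Q" "\<tau> \<in> carrier \<Gamma>Q" "\<upsilon> \<in> carrier \<Gamma>Q"
  show "\<sigma> \<otimes>\<^bsub>\<Gamma>Q\<^esub> \<tau> \<otimes>\<^bsub>\<Gamma>Q\<^esub> \<upsilon> = \<sigma> \<otimes>\<^bsub>\<Gamma>Q\<^esub> (\<tau> \<otimes>\<^bsub>\<Gamma>Q\<^esub> \<upsilon>)"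
    using s * by (intro \<Gamma>Q_eqI) auto
  show "\<one>\<^bsub>\<Gamma>Q\<^esub> \<otimes>\<^bsub>\<Gamma>Q\<^esub> \<sigma> = \<sigma>"
    using s * one by (intro \<Gamma>Q_eqI) auto
qed

lemma \<Gamma>Q_inv_apply [simp]:
  assumes "\<sigma> \<in> carrier \<Gamma>Q" "z \<in> Qbar"
  shows "(inv\<^bsub>\<Gamma>Q\<^esub> \<sigma>) (\<sigma> z) = z" "\<sigma> ((inv\<^bsub>\<Gamma>Q\<^esub> \<sigma>) z) = z"
  using assms \<Gamma>Q_mult_apply[of "inv\<^bsub>\<Gamma>Q\<^esub> \<sigma>" \<sigma> z] \<Gamma>Q_mult_apply[of \<sigma> "inv\<^bsub>\<Gamma>Q\<^esub> \<sigma>" z]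
  by (simp_all del: \<Gamma>Q_mult_apply)

lemma \<Gamma>_subgroup: "L \<subseteq> Qbar \<Longrightarrow> subgroup (carrier (\<Gamma> L)) \<Gamma>Q"
proof (rule \<Gamma>Q.subgroupI)
  assume L: "L \<subseteq> Qbar"
  have "\<one>\<^bsub>\<Gamma>Q\<^esub> \<in> carrier (\<Gamma> L)" using L by (auto simp: \<Gamma>_iff_fixes[of _ L] subset_iff)
  then show "carrier (\<Gamma> L) \<noteq> {}" by blast
  show "inv\<^bsub>\<Gamma>Q\<^esub> a \<in> carrier (\<Gamma> L)" if "a \<in> carrier (\<Gamma> L)" for a
  proof -
    have "(inv\<^bsub>\<Gamma>Q\<^esub> a) z = z" if "z \<in> L" for z
    proof -
      have "a \<in> carrier \<Gamma>Q" "a z = z" "z \<in> Qbar"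
        using that L \<open>a \<in> carrier (\<Gamma> L)\<close> by (auto simp: \<Gamma>_iff_fixes[of _ L])
      then show ?thesis using \<Gamma>Q_inv_apply(1) by metis
    qed
    then show ?thesis using that by (auto simp: \<Gamma>_iff_fixes[of _ L])
  qed
qed (auto simp: \<Gamma>_iff_fixes[of _ L])

lemma \<Gamma>_is_group: "L \<subseteq> Qbar \<Longrightarrow> group (\<Gamma> L)"
  using \<Gamma>Q.subgroup_imp_group[OF \<Gamma>_subgroup, of L] by (subst \<Gamma>_eq)

lemma \<Gamma>_mult: "x \<otimes>\<^bsub>\<Gamma> L\<^esub> y = x \<otimes>\<^bsub>\<Gamma>Q\<^esub> y"
  by (simp add: \<Gamma>_def Gal_def)

lemma \<Gamma>_inv: "L \<subseteq> Qbar \<Longrightarrow> x \<in> carrier (\<Gamma> L) \<Longrightarrow> inv\<^bsub>\<Gamma> L\<^esub> x = inv\<^bsub>\<Gamma>Q\<^esub> x"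
  using \<Gamma>Q.m_inv_consistent[OF \<Gamma>_subgroup] by (metis \<Gamma>_eq)

section \<open>Complex conjugation and restriction to subfields\<close>

lemma conj_Q_\<Gamma>Q [simp]: "conj_Q \<in> carrier \<Gamma>Q"
  by (simp add: \<Gamma>Q_iff_embs conj_Q_embs)

lemma conj_pow_\<Gamma>Q [simp]: "conj_pow e \<in> carrier \<Gamma>Q"
  by (simp add: conj_pow_def)

lemma conj_Q_square: "conj_Q \<otimes>\<^bsub>\<Gamma>Q\<^esub> conj_Q = \<one>\<^bsub>\<Gamma>Q\<^esub>"
  by (rule \<Gamma>Q_eqI) (simp_all, simp add: conj_Q_def)

lemma conj_pow_add: "conj_pow (d + e) = conj_pow d \<otimes>\<^bsub>\<Gamma>Q\<^esub> conj_pow e"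
  by (cases d; cases e) (auto simp: conj_pow_def conj_Q_square)

lemma conj_pow_inv: "inv\<^bsub>\<Gamma>Q\<^esub> (conj_pow e) = conj_pow e"
  by (rule \<Gamma>Q.inv_equality) (simp_all add: conj_pow_add[symmetric], simp add: conj_pow_def)

text \<open>The dictionary between embeddings and left cosets: applying \<open>\<sigma>\<close> to
  the condition that the quotient fixes \<open>z\<close> turns it into equality of the two values at
  \<open>z\<close>.\<close>

lemma restrict_eq_iff_inv_mult:
  assumes "\<sigma> \<in> carrier \<Gamma>Q" "\<tau> \<in> carrier \<Gamma>Q" "L \<subseteq> Qbar"
  shows "restrict \<sigma> L = restrict \<tau> L \<longleftrightarrow> inv\<^bsub>\<Gamma>Q\<^esub> \<sigma> \<otimes>\<^bsub>\<Gamma>Q\<^esub> \<tau> \<in> carrier (\<Gamma> L)"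
proof -
  have "(inv\<^bsub>\<Gamma>Q\<^esub> \<sigma> \<otimes>\<^bsub>\<Gamma>Q\<^esub> \<tau>) z = z \<longleftrightarrow> \<sigma> z = \<tau> z" if "z \<in> L" for z
  proof -
    have z: "z \<in> Qbar" using that assms(3) by blast
    then have "(inv\<^bsub>\<Gamma>Q\<^esub> \<sigma>) (\<tau> z) = z \<longleftrightarrow> \<sigma> z = \<tau> z"
      using \<Gamma>Q_inv_apply(1)[OF assms(1) z] \<Gamma>Q_inv_apply(2)[OF assms(1), of "\<tau> z"] assms(2)
      by (metis \<Gamma>Q_closed)
    then show ?thesis using z assms by simp
  qed
  then show ?thesis
    using assms by (auto simp: \<Gamma>_iff_fixes[of _ L] restrict_def fun_eq_iff)
qed

lemma restrict_mult_\<Gamma>: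
  assumes "\<sigma> \<in> carrier \<Gamma>Q" "\<kappa> \<in> carrier (\<Gamma> L)" "L \<subseteq> Qbar"
  shows "restrict (\<sigma> \<otimes>\<^bsub>\<Gamma>Q\<^esub> \<kappa>) L = restrict \<sigma> L"
  using assms by (auto simp: \<Gamma>_iff_fixes[of _ L] restrict_def fun_eq_iff)

lemma restrict_mult_cong:
  assumes "\<upsilon> \<in> carrier \<Gamma>Q" "\<sigma> \<in> carrier \<Gamma>Q" "\<tau> \<in> carrier \<Gamma>Q" "restrict \<sigma> L = restrict \<tau> L" "L \<subseteq> Qbar"
  shows "restrict (\<upsilon> \<otimes>\<^bsub>\<Gamma>Q\<^esub> \<sigma>) L = restrict (\<upsilon> \<otimes>\<^bsub>\<Gamma>Q\<^esub> \<tau>) L"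
proof (rule restrict_ext)
  fix z assume z: "z \<in> L"
  then have "z \<in> Qbar" "\<sigma> z = \<tau> z" using assms(4,5) by (auto dest: fun_cong[of _ _ z])
  then show "(\<upsilon> \<otimes>\<^bsub>\<Gamma>Q\<^esub> \<sigma>) z = (\<upsilon> \<otimes>\<^bsub>\<Gamma>Q\<^esub> \<tau>) z" using assms(1-3) by simp
qed

lemma restrict_\<Gamma>Q_embs:
  assumes "\<sigma> \<in> carrier \<Gamma>Q" "subfield L CC" "L \<subseteq> Qbar"
  shows "restrict \<sigma> L \<in> embs L"
  using embs_restrict assms by (simp add: \<Gamma>Q_iff_embs)

lemma lifts_iff: "\<sigma> \<in> lifts L \<rho> \<longleftrightarrow> \<sigma> \<in> carrier \<Gamma>Q \<and> restrict \<sigma> L = \<rho>"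
  by (simp add: lifts_def)

lemma coset_repsD:
  assumes "coset_reps L s" "\<rho> \<in> embs L"
  shows "s \<rho> \<in> carrier \<Gamma>Q" "restrict (s \<rho>) L = \<rho>" "z \<in> L \<Longrightarrow> s \<rho> z = \<rho> z"
  using assms by (auto simp: coset_reps_def lifts_def) (metis restrict_apply')

section \<open>CM fields\<close>

text \<open>Dimension is built up from line extensions, so \<open>K\<close> is spanned over
  \<open>L\<close> by some \<open>v\<close> and \<open>u\<close>. Expressing 1 and
  \<open>\<delta>\<close> through these and inverting the two by two system shows that 1 and
  \<open>\<delta>\<close> span \<open>K\<close> as well.\<close>

lemma quadratic_extension_basis:
  assumes "subfield L CC" "CC.dimension 2 L K" "1 \<in> K" "\<delta> \<in> K" "\<delta> \<notin> L" "z \<in> K"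
  obtains a b where "a \<in> L" "b \<in> L" "z = a + b * \<delta>"
proof -
  note L = subfield_CC_simps[OF assms(1)]
  have "CC.dimension (Suc (Suc 0)) L K" using assms(2) by (simp add: numeral_2_eq_2)
  then obtain v E where E: "K = CC.line_extension L v E" "CC.dimension (Suc 0) L E"
    by (cases rule: CC.dimension.cases) auto
  from E(2) obtain u E' where E': "E = CC.line_extension L u E'" "CC.dimension 0 L E'"
    by (cases rule: CC.dimension.cases) auto
  from E'(2) have "E' = {0}"
    by (cases rule: CC.dimension.cases) auto
  then have E_iff: "y \<in> E \<longleftrightarrow> (\<exists>b\<in>L. y = b * u)" for y
    by (simp add: E'(1) CC.line_extension_mem_iff)
  have K_iff: "z \<in> K \<longleftrightarrow> (\<exists>a\<in>L. \<exists>y\<in>E. z = a * v + y)" for z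
    by (simp add: E(1) CC.line_extension_mem_iff)
  have Bex_E: "(\<exists>y\<in>E. z = c + y) \<longleftrightarrow> (\<exists>b\<in>L. z = c + b * u)" for z c
    unfolding Bex_def E_iff by blast
  have K: "z \<in> K \<longleftrightarrow> (\<exists>a\<in>L. \<exists>b\<in>L. z = a * v + b * u)" for z
    unfolding K_iff Bex_E ..
  obtain a b where ab: "a \<in> L" "b \<in> L" "1 = a * v + b * u" using assms(3) K[of 1] by blast
  obtain c d where cd: "c \<in> L" "d \<in> L" "\<delta> = c * v + d * u" using assms(4) K[of \<delta>] by blast
  obtain e f where ef: "e \<in> L" "f \<in> L" "z = e * v + f * u" using assms(6) K[of z] by blast
  \<comment> \<open>The determinant of 1 and \<open>\<delta>\<close> with respect to
    \<open>v\<close> and \<open>u\<close>. If it vanished, elimination would give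
    \<open>a * \<delta> = c\<close> and \<open>b * \<delta> = d\<close>; as \<open>\<delta>\<close>
    lies outside \<open>L\<close>, both \<open>a\<close> and \<open>b\<close> would be 0,
    contradicting the expression for 1.\<close>
  define D where "D = a * d - b * c"
  have "D \<noteq> 0"
  proof
    assume "D = 0"
    then have D: "a * d = b * c" by (simp add: D_def)
    have "a * \<delta> - c * (a * v + b * u) = (a * d - b * c) * u"
      "b * \<delta> - d * (a * v + b * u) = (b * c - a * d) * v"
      unfolding cd(3) by (simp_all add: algebra_simps)
    then have e: "a * \<delta> = c" "b * \<delta> = d"
      by (simp_all add: ab(3)[symmetric] D)
    have "a = 0"
    proof (rule ccontr)
      assume "a \<noteq> 0"
      then have "\<delta> = c / a" using e(1) by (simp add: field_simps)
      then show False using L(6)[OF cd(1) ab(1)] assms(5) by simp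
    qed
    moreover have "b = 0"
    proof (rule ccontr)
      assume "b \<noteq> 0"
      then have "\<delta> = d / b" using e(2) by (simp add: field_simps)
      then show False using L(6)[OF cd(2) ab(2)] assms(5) by simp
    qed
    ultimately show False using ab(3) by simp
  qed
  \<comment> \<open>Cramer's rule for \<open>v\<close> and \<open>u\<close> in terms of 1 and
    \<open>\<delta>\<close>.\<close>
  moreover have "D * v = d - b * \<delta>" "D * u = a * \<delta> - c"
  proof -
    have "D * v = d * (a * v + b * u) - b * \<delta>" "D * u = a * \<delta> - c * (a * v + b * u)"
      unfolding D_def cd(3) by (simp_all add: algebra_simps)
    then show "D * v = d - b * \<delta>" "D * u = a * \<delta> - c" by (simp_all add: ab(3)[symmetric])
  qed
  ultimately have vu: "v = (d - b * \<delta>) / D" "u = (a * \<delta> - c) / D" by (simp_all add: field_simps)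
  have "z = (e * d - f * c) / D + (f * a - e * b) / D * \<delta>"
    unfolding ef(3) vu by (simp add: algebra_simps add_divide_distrib diff_divide_distrib)
  moreover have "(e * d - f * c) / D \<in> L" "(f * a - e * b) / D \<in> L"
    unfolding D_def using ab(1,2) cd(1,2) ef(1,2) by (simp_all add: L)
  ultimately show thesis using that by blast
qed

lemma conj_emb_restrict:
  "restrict (conj_Q \<otimes>\<^bsub>\<Gamma>Q\<^esub> \<sigma>) L = conj_emb L (restrict \<sigma> L)"
  if "\<sigma> \<in> carrier \<Gamma>Q" "L \<subseteq> Qbar"
  using that by (auto simp: conj_emb_def compose_def restrict_def fun_eq_iff)

lemma conj_emb_embs:
  assumes "subfield L CC" "\<rho> \<in> embs L"
  shows "conj_emb L \<rho> \<in> embs L"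
  unfolding conj_emb_def using assms conj_Q_embs by (intro embs_compose)

lemma conj_emb_apply: "\<rho> \<in> embs L \<Longrightarrow> z \<in> L \<Longrightarrow> conj_emb L \<rho> z = cnj (\<rho> z)"
  by (auto simp: conj_emb_def compose_eq conj_Q_def embs_iff)

lemma embs_eqI:
  assumes "\<rho> \<in> embs L" "\<rho>' \<in> embs L" "\<And>z. z \<in> L \<Longrightarrow> \<rho> z = \<rho>' z"
  shows "\<rho> = \<rho>'"
  using assms by (auto simp: embs_iff intro: extensionalityI)

locale CM_pair =
  fixes K F :: "complex set"
  assumes CM: "CM_field K" and max_F: "max_totally_real_subfield F K"
begin

lemma K_subfield: "subfield K CC" and K_Qbar: "K \<subseteq> Qbar"
  and F_subfield: "subfield F CC" and F_Qbar: "F \<subseteq> Qbar" and F_K: "F \<subseteq> K"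
  using CM max_F number_field_subset_Qbar
  by (auto simp: CM_field_def totally_imaginary_def totally_real_def number_field_def
      max_totally_real_subfield_def)

lemma embs_F_real: "x \<in> embs F \<Longrightarrow> z \<in> F \<Longrightarrow> x z \<in> \<real>"
  using max_F by (auto simp: max_totally_real_subfield_def totally_real_def)

lemma embs_K_not_real: "\<rho> \<in> embs K \<Longrightarrow> \<exists>z\<in>K. \<rho> z \<notin> \<real>"
  using CM by (auto simp: CM_field_def totally_imaginary_def)

text \<open>Through the inclusion, conditions on all embeddings become statements about the numbers
  in \<open>K\<close> and \<open>F\<close> themselves.\<close>

lemma incl_embs: "restrict (\<lambda>z. z) K \<in> embs K"
  using K_Qbar subfield_CC_simps[OF K_subfield] by (auto simp: embs_iff)

lemma F_real: "F \<subseteq> \<real>"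
  using embs_F_real[OF embs_restrict[OF incl_embs F_subfield F_K]] F_K by (auto simp: subset_iff)

text \<open>The definition of a CM field provides some totally real \<open>L\<close> over which
  \<open>K\<close> has dimension 2; maximality of \<open>F\<close> puts \<open>L\<close> inside
  \<open>F\<close>. An element \<open>\<delta>\<close> outside \<open>F\<close> exists because
  \<open>K\<close> has non-real elements, and it is then outside \<open>L\<close> too.\<close>

lemma K_basis:
  obtains \<delta> where "\<delta> \<in> K" "\<And>z. z \<in> K \<Longrightarrow> \<exists>a\<in>F. \<exists>b\<in>F. z = a + b * \<delta>"
proof -
  obtain L where L: "totally_real L" "L \<subseteq> K" "CC.dimension 2 L K"
    using CM by (auto simp: CM_field_def)
  then have LF: "L \<subseteq> F" using max_F by (auto simp: max_totally_real_subfield_def)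
  have sL: "subfield L CC" using L(1) by (simp add: totally_real_def number_field_def)
  obtain \<delta> where \<delta>: "\<delta> \<in> K" "\<delta> \<notin> F"
    using embs_K_not_real[OF incl_embs] F_real by auto
  have "\<exists>a\<in>F. \<exists>b\<in>F. z = a + b * \<delta>" if "z \<in> K" for z
    using quadratic_extension_basis[OF sL L(3) _ \<delta>(1) _ that] \<delta>(2) LF
      subfield_CC_simps(2)[OF K_subfield] by (metis subsetD)
  then show thesis using that \<delta>(1) by blast
qed

lemma conj_emb_embs_K [simp]: "\<rho> \<in> embs K \<Longrightarrow> conj_emb K \<rho> \<in> embs K"
  using conj_emb_embs K_subfield by blast

lemma conj_emb_neq: "\<rho> \<in> embs K \<Longrightarrow> conj_emb K \<rho> \<noteq> \<rho>"
  using embs_K_not_real[of \<rho>] conj_emb_apply[of \<rho> K] by (metis Reals_cnj_iff)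

lemma conj_emb_conj_emb: "\<rho> \<in> embs K \<Longrightarrow> conj_emb K (conj_emb K \<rho>) = \<rho>"
  by (rule embs_eqI[of _ K]) (auto simp: conj_emb_apply)

lemma embs_K_real_on_F: "\<rho> \<in> embs K \<Longrightarrow> z \<in> F \<Longrightarrow> \<rho> z \<in> \<real>"
  using embs_F_real[OF embs_restrict[OF _ F_subfield F_K]] by fastforce

text \<open>
  With \<open>K = F + F\<delta>\<close>, the values at \<open>\<delta>\<close> of two embeddings agreeing on \<open>F\<close> are roots of the
  same real quadratic polynomial, whose roots are complex conjugate.
\<close>

lemma embs_K_eq_or_conj:
  assumes \<rho>: "\<rho> \<in> embs K" and \<rho>': "\<rho>' \<in> embs K" and eq: "\<And>z. z \<in> F \<Longrightarrow> \<rho> z = \<rho>' z"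
  shows "\<rho>' = \<rho> \<or> \<rho>' = conj_emb K \<rho>"
proof -
  obtain \<delta> where \<delta>: "\<delta> \<in> K" "\<And>z. z \<in> K \<Longrightarrow> \<exists>a\<in>F. \<exists>b\<in>F. z = a + b * \<delta>" using K_basis by blast
  note K = subfield_CC_simps[OF K_subfield]
  obtain q p where pq: "q \<in> F" "p \<in> F" "\<delta> * \<delta> = q + p * \<delta>"
    using \<delta> K(4) by blast
  have pqK: "p \<in> K" "q \<in> K" using pq F_K by auto
  have ex: "\<tau> (a + b * \<delta>) = \<tau> a + \<tau> b * \<tau> \<delta>" if "\<tau> \<in> embs K" "a \<in> F" "b \<in> F" for \<tau> a b
    using embs_simps[OF K_subfield that(1)] that(2,3) F_K \<delta>(1) K by (simp add: subset_iff)
  have root: "\<tau> \<delta> * \<tau> \<delta> = \<tau> q + \<tau> p * \<tau> \<delta>" if "\<tau> \<in> embs K" for \<tau>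
    using ex[OF that pq(1,2)] embs_simps(3)[OF K_subfield that \<delta>(1) \<delta>(1)] pq(3) by simp
  have agree: "\<tau> = \<tau>'"
    if "\<tau> \<in> embs K" "\<tau>' \<in> embs K" "\<tau> \<delta> = \<tau>' \<delta>" "\<And>z. z \<in> F \<Longrightarrow> \<tau> z = \<tau>' z" for \<tau> \<tau>'
  proof (rule embs_eqI[OF that(1,2)])
    fix z assume "z \<in> K"
    then show "\<tau> z = \<tau>' z" using \<delta>(2)[of z] ex[OF that(1)] ex[OF that(2)] that(3,4) by auto
  qed
  have cF: "conj_emb K \<rho> z = \<rho> z" if "z \<in> F" for z
    using that \<rho> F_K embs_K_real_on_F[OF \<rho> that] by (auto simp: conj_emb_apply Reals_cnj_iff)
  have ne: "conj_emb K \<rho> \<delta> \<noteq> \<rho> \<delta>"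
    using agree[of "conj_emb K \<rho>" \<rho>] \<rho> cF conj_emb_neq by auto
  have r: "\<tau> \<delta> = \<rho> \<delta> \<or> \<tau> \<delta> = \<rho> p - \<rho> \<delta>" if "\<tau> \<in> embs K" "\<And>z. z \<in> F \<Longrightarrow> \<tau> z = \<rho> z" for \<tau>
  proof -
    have "(\<tau> \<delta> - \<rho> \<delta>) * (\<tau> \<delta> - (\<rho> p - \<rho> \<delta>)) = 0"
      using root[OF that(1)] root[OF \<rho>]
      unfolding that(2)[OF pq(1)] that(2)[OF pq(2)] by (simp add: algebra_simps)
    then show ?thesis by auto
  qed
  \<comment> \<open>The two roots add up to \<open>\<rho> p\<close>. The conjugate embedding takes a
    value other than \<open>\<rho> \<delta>\<close>, so its value is the second root, and the value
    of \<open>\<rho>'\<close> is one of the two.\<close>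
  have "\<rho>' \<delta> = \<rho> \<delta> \<or> \<rho>' \<delta> = conj_emb K \<rho> \<delta>"
    using r[of "conj_emb K \<rho>"] r[of \<rho>'] \<rho> \<rho>' cF ne eq by auto
  then show ?thesis
    using agree[of \<rho>' \<rho>] agree[of \<rho>' "conj_emb K \<rho>"] \<rho> \<rho>' cF eq by auto
qed

end

section \<open>Exponents of complex conjugation\<close>

context CM_pair
begin

text \<open>The image of \<open>F\<close> under \<open>\<sigma>\<close> is real because
  \<open>F\<close> is totally real.\<close>

lemma conj_fixes_F:
  assumes "\<sigma> \<in> carrier \<Gamma>Q" "z \<in> F"
  shows "conj_pow e (\<sigma> z) = \<sigma> z"
proof -
  have "\<sigma> z \<in> \<real>" "\<sigma> z \<in> Qbar"
    using embs_F_real[OF restrict_\<Gamma>Q_embs[OF assms(1) F_subfield F_Qbar] assms(2)] assms F_Qbar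
    by auto
  then show ?thesis by (auto simp: conj_pow_def conj_Q_def Reals_cnj_iff)
qed

text \<open>An embedding of the totally imaginary field \<open>K\<close> never equals its
  conjugate.\<close>

lemma restrict_conj_pow_inj:
  assumes "\<sigma> \<in> carrier \<Gamma>Q"
    and "restrict (conj_pow d \<otimes>\<^bsub>\<Gamma>Q\<^esub> \<sigma>) K = restrict (conj_pow e \<otimes>\<^bsub>\<Gamma>Q\<^esub> \<sigma>) K"
  shows "d = e"
  using assms conj_emb_neq[OF restrict_\<Gamma>Q_embs[OF assms(1) K_subfield K_Qbar]]
    conj_emb_restrict[OF assms(1) K_Qbar]
  by (cases d; cases e) (auto simp: conj_pow_def)

text \<open>Existence, to match the uniqueness just shown: the embeddings of \<open>K\<close> above
  one embedding of \<open>F\<close> form a single orbit under complex conjugation.\<close>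

lemma restrict_eq_conj_pow:
  assumes "\<sigma> \<in> carrier \<Gamma>Q" "\<tau> \<in> carrier \<Gamma>Q" "restrict \<sigma> F = restrict \<tau> F"
  shows "\<exists>e. restrict \<tau> K = restrict (conj_pow e \<otimes>\<^bsub>\<Gamma>Q\<^esub> \<sigma>) K"
proof -
  have "restrict \<sigma> K z = restrict \<tau> K z" if "z \<in> F" for z
    using assms(3) that F_K by (metis restrict_apply' subsetD)
  then have "restrict \<tau> K = restrict \<sigma> K \<or> restrict \<tau> K = conj_emb K (restrict \<sigma> K)"
    using assms restrict_\<Gamma>Q_embs K_subfield K_Qbar by (intro embs_K_eq_or_conj) auto
  then consider "restrict \<tau> K = restrict (conj_pow 0 \<otimes>\<^bsub>\<Gamma>Q\<^esub> \<sigma>) K"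
    | "restrict \<tau> K = restrict (conj_pow 1 \<otimes>\<^bsub>\<Gamma>Q\<^esub> \<sigma>) K"
    using assms conj_emb_restrict[OF assms(1) K_Qbar] by (auto simp: conj_pow_def)
  then show ?thesis by cases blast+
qed

lemma conj_exponent_eqI:
  assumes "\<kappa> \<in> carrier \<Gamma>Q" "restrict \<kappa> K = restrict (conj_pow e) K"
  shows "conj_exponent K \<kappa> = e"
  unfolding conj_exponent_def
  by (rule the_equality)
    (use assms restrict_conj_pow_inj[OF \<Gamma>Q.one_closed] in auto)

lemma conj_exponent:
  assumes "\<kappa> \<in> carrier (\<Gamma> F)"
  shows "restrict \<kappa> K = restrict (conj_pow (conj_exponent K \<kappa>)) K"
proof -
  have \<kappa>: "\<kappa> \<in> carrier \<Gamma>Q" "restrict \<one>\<^bsub>\<Gamma>Q\<^esub> F = restrict \<kappa> F"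
    using assms F_Qbar by (auto simp: \<Gamma>_iff_fixes[of _ F] restrict_def fun_eq_iff)
  then obtain e where "restrict \<kappa> K = restrict (conj_pow e) K"
    using restrict_eq_conj_pow[OF \<Gamma>Q.one_closed \<kappa>] by auto
  with conj_exponent_eqI[OF \<kappa>(1)] show ?thesis by auto
qed

text \<open>The characteristic property of CM fields: conjugation induces the same automorphism of
  \<open>K\<close> through every embedding, so a right factor from \<open>\<Gamma> F\<close> may be
  traded for a power of \<open>c\<close> on the left. Some exponent \<open>e\<close> exists, and
  \<open>e\<close> and \<open>conj_exponent K \<kappa>\<close> both vanish exactly when
  \<open>\<kappa>\<close> fixes \<open>K\<close>.\<close>

lemma restrict_mult_conj_exponent:
  assumes "\<sigma> \<in> carrier \<Gamma>Q" "\<kappa> \<in> carrier (\<Gamma> F)"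
  shows "restrict (\<sigma> \<otimes>\<^bsub>\<Gamma>Q\<^esub> \<kappa>) K = restrict (conj_pow (conj_exponent K \<kappa>) \<otimes>\<^bsub>\<Gamma>Q\<^esub> \<sigma>) K"
proof -
  have \<kappa>: "\<kappa> \<in> carrier \<Gamma>Q" using assms(2) carrier_\<Gamma>_subset by blast
  obtain e where e: "restrict (\<sigma> \<otimes>\<^bsub>\<Gamma>Q\<^esub> \<kappa>) K = restrict (conj_pow e \<otimes>\<^bsub>\<Gamma>Q\<^esub> \<sigma>) K"
    using restrict_eq_conj_pow[OF assms(1), of "\<sigma> \<otimes>\<^bsub>\<Gamma>Q\<^esub> \<kappa>"] \<kappa>
      restrict_mult_\<Gamma>[OF assms F_Qbar] assms(1) by auto
  have zero: "conj_exponent K \<kappa> = 0 \<longleftrightarrow> \<kappa> \<in> carrier (\<Gamma> K)"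
    if "\<kappa> \<in> carrier (\<Gamma> F)" for \<kappa>
  proof
    have \<kappa>: "\<kappa> \<in> carrier \<Gamma>Q" using that carrier_\<Gamma>_subset by blast
    show "\<kappa> \<in> carrier (\<Gamma> K)" if "conj_exponent K \<kappa> = 0"
    proof -
      have "\<kappa> z = z" if "z \<in> K" for z
        using fun_cong[OF conj_exponent[OF \<open>\<kappa> \<in> carrier (\<Gamma> F)\<close>], of z] \<open>conj_exponent K \<kappa> = 0\<close>
          that K_Qbar by (auto simp: conj_pow_def)
      then show ?thesis using \<kappa> by (simp add: \<Gamma>_iff_fixes[of _ K])
    qed
    show "conj_exponent K \<kappa> = 0" if "\<kappa> \<in> carrier (\<Gamma> K)"
      using that K_Qbar
      by (intro conj_exponent_eqI \<kappa>) (auto simp: \<Gamma>_iff_fixes[of _ K] conj_pow_def restrict_def fun_eq_iff)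
  qed
  have "conj_pow 0 \<otimes>\<^bsub>\<Gamma>Q\<^esub> \<sigma> = \<sigma>" using assms(1) by (simp add: conj_pow_def)
  then have "e = 0 \<longleftrightarrow> restrict (\<sigma> \<otimes>\<^bsub>\<Gamma>Q\<^esub> \<kappa>) K = restrict \<sigma> K"
    unfolding e using restrict_conj_pow_inj[OF assms(1), of e 0] by metis
  also have "\<dots> \<longleftrightarrow> \<kappa> \<in> carrier (\<Gamma> K)"
    using restrict_eq_iff_inv_mult[OF assms(1) _ K_Qbar, of "\<sigma> \<otimes>\<^bsub>\<Gamma>Q\<^esub> \<kappa>"] assms(1) \<kappa>
    by (simp add: \<Gamma>Q.m_assoc[symmetric] eq_commute)
  also have "\<dots> \<longleftrightarrow> conj_exponent K \<kappa> = 0" using zero[OF assms(2)] by simp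
  \<comment> \<open>An element of Z/2 is determined by whether it vanishes.\<close>
  finally have "e = conj_exponent K \<kappa>" by (cases e; cases "conj_exponent K \<kappa>") auto
  with e show ?thesis by simp
qed

end

section \<open>The abelianized Galois group\<close>

text \<open>Ensures that the union \<open>max_abelian_extension K\<close> contains \<open>K\<close>;
  the group in question is trivial.\<close>

lemma abelian_extension_self:
  assumes "subfield K CC" "K \<subseteq> Qbar"
  shows "abelian_extension K K"
proof -
  have "carrier (Gal K K) = {\<lambda>z\<in>K. z}"
    using assms subfield_CC_simps[OF assms(1)]
    by (auto simp: Gal_def ring_hom_def id_Bij Bij_def bij_betw_def inj_on_def intro!: extensionalityI[of _ K])
  moreover have "\<one>\<^bsub>Gal K K\<^esub> = (\<lambda>z\<in>K. z)" by (simp add: Gal_def BijGroup_def)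
  moreover have "(\<lambda>z\<in>K. z) \<otimes>\<^bsub>Gal K K\<^esub> (\<lambda>z\<in>K. z) = (\<lambda>z\<in>K. z)"
    by (simp add: Gal_def BijGroup_def id_Bij compose_def cong: restrict_cong)
  ultimately have "comm_group (Gal K K)"
    by (intro comm_groupI) auto
  moreover have "\<tau> ` K = K" if "\<forall>z\<in>K. \<tau> z = z" for \<tau> using that by force
  ultimately show ?thesis using assms by (auto simp: abelian_extension_def)
qed

context
  fixes K assumes K: "subfield K CC" "K \<subseteq> Qbar"
begin

lemma max_abelian_Qbar: "max_abelian_extension K \<subseteq> Qbar" "K \<subseteq> max_abelian_extension K"
  using abelian_extension_self[OF K]
  by (auto simp: max_abelian_extension_def abelian_extension_def)

text \<open>Normality makes the restriction map \<open>L\<close> onto itself; the remaining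
  conditions are inherited from \<open>\<sigma>\<close>.\<close>

lemma \<Gamma>_abelian_extension:
  assumes L: "abelian_extension K L" and \<sigma>: "\<sigma> \<in> carrier (\<Gamma> K)"
  shows "restrict \<sigma> L \<in> carrier (Gal L K)"
proof -
  have \<sigma>': "\<sigma> \<in> carrier \<Gamma>Q" "\<And>z. z \<in> K \<Longrightarrow> \<sigma> z = z" using \<sigma> by (auto simp: \<Gamma>_iff_fixes[of _ K])
  have sL: "subfield L CC" "L \<subseteq> Qbar" "K \<subseteq> L" using L by (auto simp: abelian_extension_def)
  have e: "restrict \<sigma> L \<in> embs L" using restrict_\<Gamma>Q_embs[OF \<sigma>'(1)] sL by blast
  moreover have im: "restrict \<sigma> L ` L = L"
    using L e \<sigma>'(2) sL(3) unfolding abelian_extension_def by (metis restrict_apply' subsetD)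
  moreover have "inj_on (restrict \<sigma> L) L" by (rule embs_inj_on[OF sL(1) e])
  ultimately show ?thesis
    using \<sigma>'(2) sL(3) unfolding Gal_def embs_iff
    by (auto simp: Bij_def bij_betw_def ring_hom_def subset_iff simp del: restrict_apply image_restrict_eq)
       (auto simp: sL(3)[THEN subsetD])
qed

text \<open>Each element of the maximal abelian extension lies in a single abelian \<open>L\<close>,
  so statements about the union are checked one element at a time through these two facts.\<close>

lemma \<Gamma>_commutes_on_abelian_extension:
  assumes L: "abelian_extension K L" and "\<sigma> \<in> carrier (\<Gamma> K)" "\<tau> \<in> carrier (\<Gamma> K)" "z \<in> L"
  shows "\<sigma> z \<in> L" "\<sigma> (\<tau> z) = \<tau> (\<sigma> z)"
proof -
  note s = \<Gamma>_abelian_extension[OF L assms(2)] and t = \<Gamma>_abelian_extension[OF L assms(3)]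
  interpret comm_group "Gal L K" using L by (auto simp: abelian_extension_def)
  have B: "restrict \<sigma> L \<in> Bij L" "restrict \<tau> L \<in> Bij L" using s t by (auto simp: Gal_def)
  then have c: "restrict \<sigma> L z \<in> L" "restrict \<tau> L z \<in> L"
    using assms(4) Bij_imp_funcset by blast+
  then show "\<sigma> z \<in> L" using assms(4) by simp
  have "(restrict \<sigma> L \<otimes>\<^bsub>Gal L K\<^esub> restrict \<tau> L) z = (restrict \<tau> L \<otimes>\<^bsub>Gal L K\<^esub> restrict \<sigma> L) z"
    using m_comm[OF s t] by simp
  then show "\<sigma> (\<tau> z) = \<tau> (\<sigma> z)"
    using B assms(4) c by (simp add: Gal_def BijGroup_def compose_eq)
qed

text \<open>The inverse of \<open>\<sigma>\<close> keeps \<open>z\<close> inside its abelian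
  extension, where \<open>\<nu>\<close> acts trivially; applying \<open>\<sigma>\<close> returns
  \<open>z\<close>.\<close>

lemma \<Gamma>_max_abelian_normal: "carrier (\<Gamma> (max_abelian_extension K)) \<lhd> \<Gamma> K"
proof -
  let ?N = "carrier (\<Gamma> (max_abelian_extension K))"
  interpret G: group "\<Gamma> K" using \<Gamma>_is_group[OF K(2)] .
  have sub: "?N \<subseteq> carrier (\<Gamma> K)"
    using max_abelian_Qbar(2) by (rule \<Gamma>_antimono)
  have "subgroup ?N (\<Gamma>Q\<lparr>carrier := carrier (\<Gamma> K)\<rparr>)"
    using \<Gamma>_subgroup[OF max_abelian_Qbar(1)] \<Gamma>_subgroup[OF K(2)] sub by (simp add: \<Gamma>Q.subgroup_incl)
  then have N: "subgroup ?N (\<Gamma> K)" using \<Gamma>_eq[of K] by simp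
  show ?thesis
  proof (rule G.normal_invI[OF N])
    fix \<sigma> \<nu> assume \<sigma>: "\<sigma> \<in> carrier (\<Gamma> K)" and \<nu>: "\<nu> \<in> ?N"
    have s: "\<sigma> \<in> carrier \<Gamma>Q" "\<nu> \<in> carrier \<Gamma>Q"
      using \<sigma> \<nu> carrier_\<Gamma>_subset by auto
    have i: "inv\<^bsub>\<Gamma>Q\<^esub> \<sigma> \<in> carrier (\<Gamma> K)" using \<sigma> \<Gamma>_inv[OF K(2)] G.inv_closed by metis
    have "(\<sigma> \<otimes>\<^bsub>\<Gamma>Q\<^esub> \<nu> \<otimes>\<^bsub>\<Gamma>Q\<^esub> inv\<^bsub>\<Gamma>Q\<^esub> \<sigma>) z = z" if zM: "z \<in> max_abelian_extension K" for z
    proof -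
      obtain L where L: "abelian_extension K L" "z \<in> L"
        using zM by (auto simp: max_abelian_extension_def)
      have z: "z \<in> Qbar" using that max_abelian_Qbar by auto
      have "(inv\<^bsub>\<Gamma>Q\<^esub> \<sigma>) z \<in> max_abelian_extension K"
        using \<Gamma>_commutes_on_abelian_extension(1)[OF L(1) i i L(2)] L(1)
        by (auto simp: max_abelian_extension_def)
      then have "\<nu> ((inv\<^bsub>\<Gamma>Q\<^esub> \<sigma>) z) = (inv\<^bsub>\<Gamma>Q\<^esub> \<sigma>) z"
        using \<nu> by (simp add: \<Gamma>_iff_fixes[of _ "max_abelian_extension K"])
      then show ?thesis using s z by simp
    qed
    then show "\<sigma> \<otimes>\<^bsub>\<Gamma> K\<^esub> \<nu> \<otimes>\<^bsub>\<Gamma> K\<^esub> inv\<^bsub>\<Gamma> K\<^esub> \<sigma> \<in> ?N"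
      using s \<Gamma>_inv[OF K(2) \<sigma>] by (simp add: \<Gamma>_mult[where L = K] \<Gamma>_iff_fixes[of _ "max_abelian_extension K"])
  qed
qed

lemma to_ab_hom: "to_ab K \<in> hom (\<Gamma> K) (\<Gamma>_ab K)"
  using normal.r_coset_hom_Mod[OF \<Gamma>_max_abelian_normal]
  by (simp add: to_ab_def[abs_def] \<Gamma>_ab_def)

text \<open>Two automorphisms over \<open>K\<close> commute on every abelian extension, so their
  products differ by a factor \<open>\<nu>\<close> that fixes the whole union and becomes trivial in
  the quotient.\<close>

lemma \<Gamma>_ab_comm_group: "comm_group (\<Gamma>_ab K)"
proof -
  interpret G: group "\<Gamma> K" using \<Gamma>_is_group[OF K(2)] .
  interpret N: normal "carrier (\<Gamma> (max_abelian_extension K))" "\<Gamma> K" by (rule \<Gamma>_max_abelian_normal)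
  interpret Q: group "\<Gamma>_ab K" unfolding \<Gamma>_ab_def by (rule N.factorgroup_is_group)
  show ?thesis
  proof (rule Q.group_comm_groupI)
    fix x y assume "x \<in> carrier (\<Gamma>_ab K)" "y \<in> carrier (\<Gamma>_ab K)"
    then obtain \<sigma> \<tau> where \<sigma>: "\<sigma> \<in> carrier (\<Gamma> K)" "x = to_ab K \<sigma>"
      and \<tau>: "\<tau> \<in> carrier (\<Gamma> K)" "y = to_ab K \<tau>"
      by (auto simp: \<Gamma>_ab_def FactGroup_def RCOSETS_def to_ab_def)
    have s: "\<sigma> \<in> carrier \<Gamma>Q" "\<tau> \<in> carrier \<Gamma>Q" using \<sigma> \<tau> carrier_\<Gamma>_subset by auto
    have "(\<sigma> \<otimes>\<^bsub>\<Gamma>Q\<^esub> \<tau>) z = (\<tau> \<otimes>\<^bsub>\<Gamma>Q\<^esub> \<sigma>) z" if zM: "z \<in> max_abelian_extension K" for z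
    proof -
      obtain L where L: "abelian_extension K L" "z \<in> L"
        using zM by (auto simp: max_abelian_extension_def)
      have z: "z \<in> Qbar" using that max_abelian_Qbar by auto
      then show ?thesis
        using \<Gamma>_commutes_on_abelian_extension(2)[OF L(1) \<sigma>(1) \<tau>(1) L(2)] s by simp
    qed
    then have c: "inv\<^bsub>\<Gamma>Q\<^esub> (\<tau> \<otimes>\<^bsub>\<Gamma>Q\<^esub> \<sigma>) \<otimes>\<^bsub>\<Gamma>Q\<^esub> (\<sigma> \<otimes>\<^bsub>\<Gamma>Q\<^esub> \<tau>) \<in> carrier (\<Gamma> (max_abelian_extension K))"
      using s max_abelian_Qbar(1)
      by (subst restrict_eq_iff_inv_mult[symmetric]) (auto simp: restrict_def fun_eq_iff)
    define \<nu> where "\<nu> = inv\<^bsub>\<Gamma>Q\<^esub> (\<tau> \<otimes>\<^bsub>\<Gamma>Q\<^esub> \<sigma>) \<otimes>\<^bsub>\<Gamma>Q\<^esub> (\<sigma> \<otimes>\<^bsub>\<Gamma>Q\<^esub> \<tau>)"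
    have "\<sigma> \<otimes>\<^bsub>\<Gamma>Q\<^esub> \<tau> = (\<tau> \<otimes>\<^bsub>\<Gamma>Q\<^esub> \<sigma>) \<otimes>\<^bsub>\<Gamma>Q\<^esub> \<nu>"
      unfolding \<nu>_def using s by (simp add: \<Gamma>Q.m_assoc[symmetric] \<Gamma>Q.r_inv)
    have \<nu>: "\<nu> \<in> carrier (\<Gamma> (max_abelian_extension K))" "\<nu> \<in> carrier (\<Gamma> K)"
      using c N.subset by (auto simp: \<nu>_def)
    have one: "to_ab K \<nu> = \<one>\<^bsub>\<Gamma>_ab K\<^esub>"
      unfolding to_ab_def \<Gamma>_ab_def FactGroup_def using \<nu>(1) by (simp add: N.rcos_const)
    have eq: "\<sigma> \<otimes>\<^bsub>\<Gamma> K\<^esub> \<tau> = (\<tau> \<otimes>\<^bsub>\<Gamma> K\<^esub> \<sigma>) \<otimes>\<^bsub>\<Gamma> K\<^esub> \<nu>"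
      using \<open>\<sigma> \<otimes>\<^bsub>\<Gamma>Q\<^esub> \<tau> = (\<tau> \<otimes>\<^bsub>\<Gamma>Q\<^esub> \<sigma>) \<otimes>\<^bsub>\<Gamma>Q\<^esub> \<nu>\<close> by (simp add: \<Gamma>_mult[where L = K])
    have h: "to_ab K (a \<otimes>\<^bsub>\<Gamma> K\<^esub> b) = to_ab K a \<otimes>\<^bsub>\<Gamma>_ab K\<^esub> to_ab K b" "to_ab K a \<in> carrier (\<Gamma>_ab K)"
      if "a \<in> carrier (\<Gamma> K)" "b \<in> carrier (\<Gamma> K)" for a b
      using to_ab_hom that by (auto simp: hom_def)
    show "x \<otimes>\<^bsub>\<Gamma>_ab K\<^esub> y = y \<otimes>\<^bsub>\<Gamma>_ab K\<^esub> x"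
      using arg_cong[OF eq, of "to_ab K"] \<sigma> \<tau> \<nu>(2) one h by simp
  qed
qed

end

section \<open>The tensor product\<close>

lemma frag_extend_fun_add:
  "frag_extend (\<lambda>p. u p + v p) f = frag_extend u f + frag_extend v f"
  by (simp add: frag_extend_def frag_cmul_distrib2 sum.distrib)

lemma frag_extend_fun_diff:
  "frag_extend (\<lambda>p. u p - v p) f = frag_extend u f - frag_extend v f"
  using frag_extend_fun_add[of "\<lambda>p. u p - v p" v f] by simp

text \<open>The product of \<open>free_pairs\<close>, which does not depend on the two fields; the
  ring laws can thus be proved for all formal sums at once.\<close>

definition pairs_mult ::
  "((complex \<times> complex) \<Rightarrow>\<^sub>0 int) \<Rightarrow> ((complex \<times> complex) \<Rightarrow>\<^sub>0 int) \<Rightarrow> ((complex \<times> complex) \<Rightarrow>\<^sub>0 int)"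
  where "pairs_mult f f' =
    frag_extend (\<lambda>p. frag_extend (\<lambda>q. frag_of (fst p * fst q, snd p * snd q)) f') f"

lemma pairs_mult_of [simp]: "pairs_mult (frag_of (a, b)) (frag_of (a', b')) = frag_of (a * a', b * b')"
  by (simp add: pairs_mult_def)

lemma pairs_mult_zero [simp]: "pairs_mult 0 f = 0" "pairs_mult f 0 = 0"
  by (simp_all add: pairs_mult_def frag_extend_eq_0)

lemma pairs_mult_linear:
  "pairs_mult (f + f') g = pairs_mult f g + pairs_mult f' g"
  "pairs_mult (f - f') g = pairs_mult f g - pairs_mult f' g"
  "pairs_mult g (f - f') = pairs_mult g f - pairs_mult g f'"
  by (simp_all add: pairs_mult_def frag_extend_add frag_extend_diff frag_extend_fun_diff)

text \<open>Additivity in each argument reduces the claim to generators. The induction on formal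
  sums proceeds through differences, hence the corresponding rules in
  \<open>pairs_mult_linear\<close>.\<close>

lemma pairs_mult_comm: "pairs_mult f g = pairs_mult g f"
proof (rule frag_induction[of f UNIV])
  show "pairs_mult (frag_of p) g = pairs_mult g (frag_of p)" for p
    by (rule frag_induction[of g UNIV]; cases p) (auto simp: pairs_mult_linear mult.commute)
qed (auto simp: pairs_mult_linear)

lemma pairs_mult_assoc: "pairs_mult (pairs_mult f g) h = pairs_mult f (pairs_mult g h)"
proof (rule frag_induction[of f UNIV])
  have *: "pairs_mult (pairs_mult (frag_of p) (frag_of q)) h = pairs_mult (frag_of p) (pairs_mult (frag_of q) h)" for p q
    by (rule frag_induction[of h UNIV]; cases p; cases q) (auto simp: pairs_mult_linear mult.assoc)
  show "pairs_mult (pairs_mult (frag_of p) g) h = pairs_mult (frag_of p) (pairs_mult g h)" for p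
    by (rule frag_induction[of g UNIV]) (auto simp: pairs_mult_linear *)
qed (auto simp: pairs_mult_linear)

lemma pairs_mult_one: "pairs_mult (frag_of (1, 1)) f = f"
  by (rule frag_induction[of f UNIV]) (auto simp: pairs_mult_linear)

lemma pairs_mult_keys:
  assumes "subfield A CC" "subfield B CC"
    and "Poly_Mapping.keys f \<subseteq> A \<times> B" "Poly_Mapping.keys g \<subseteq> A \<times> B"
  shows "Poly_Mapping.keys (pairs_mult f g) \<subseteq> A \<times> B"
proof -
  have *: "Poly_Mapping.keys (frag_extend (\<lambda>q. frag_of (fst p * fst q, snd p * snd q)) g) \<subseteq> A \<times> B"
    if "p \<in> A \<times> B" for p
    using keys_frag_extend[of "\<lambda>q. frag_of (fst p * fst q, snd p * snd q)" g] assms(4) that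
      subfield_CC_simps(4)[OF assms(1)] subfield_CC_simps(4)[OF assms(2)]
    by (fastforce simp: keys_frag_of)
  show ?thesis
    unfolding pairs_mult_def
    using keys_frag_extend[of "\<lambda>p. frag_extend (\<lambda>q. frag_of (fst p * fst q, snd p * snd q)) g" f]
      assms(3) * by blast
qed

lemma free_pairs_simps:
  "carrier (free_pairs A B) = {f. Poly_Mapping.keys f \<subseteq> A \<times> B}"
  "f \<otimes>\<^bsub>free_pairs A B\<^esub> g = pairs_mult f g" "\<one>\<^bsub>free_pairs A B\<^esub> = frag_of (1, 1)"
  "\<zero>\<^bsub>free_pairs A B\<^esub> = 0" "f \<oplus>\<^bsub>free_pairs A B\<^esub> g = f + g"
  by (simp_all add: free_pairs_def pairs_mult_def)

lemma cring_free_pairs: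
  assumes "subfield A CC" "subfield B CC"
  shows "cring (free_pairs A B)"
proof (rule cringI)
  show "abelian_group (free_pairs A B)"
  proof (rule abelian_groupI)
    fix f assume "f \<in> carrier (free_pairs A B)"
    then show "\<exists>g\<in>carrier (free_pairs A B). g \<oplus>\<^bsub>free_pairs A B\<^esub> f = \<zero>\<^bsub>free_pairs A B\<^esub>"
      by (intro bexI[of _ "- f"]) (auto simp: free_pairs_simps)
  qed (use Poly_Mapping.keys_add in \<open>fastforce simp: free_pairs_simps\<close>)+
  show "comm_monoid (free_pairs A B)"
    by (rule comm_monoidI)
      (use pairs_mult_keys[OF assms] subfield_CC_simps(2)[OF assms(1)] subfield_CC_simps(2)[OF assms(2)] in
        \<open>auto simp: free_pairs_simps pairs_mult_assoc pairs_mult_one keys_frag_of intro: pairs_mult_comm\<close>)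
qed (auto simp: free_pairs_simps pairs_mult_linear)

section \<open>Evaluation of formal sums at an embedding\<close>

definition pairs_eval :: "(complex \<Rightarrow> complex) \<Rightarrow> ((complex \<times> complex) \<Rightarrow>\<^sub>0 int) \<Rightarrow> complex" where
  "pairs_eval x f = (\<Sum>p\<in>Poly_Mapping.keys f. of_int (Poly_Mapping.lookup f p) * (x (fst p) * snd p))"

text \<open>Lets formal sums with different supports be evaluated over one index set, which is how
  additivity is obtained.\<close>

lemma pairs_eval_superset:
  assumes "finite S" "Poly_Mapping.keys f \<subseteq> S"
  shows "pairs_eval x f = (\<Sum>p\<in>S. of_int (Poly_Mapping.lookup f p) * (x (fst p) * snd p))"
  unfolding pairs_eval_def
  by (rule sum.mono_neutral_left) (use assms in \<open>auto simp: in_keys_iff\<close>)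

lemma pairs_eval_linear:
  "pairs_eval x 0 = 0" "pairs_eval x (f + g) = pairs_eval x f + pairs_eval x g"
  "pairs_eval x (f - g) = pairs_eval x f - pairs_eval x g"
proof -
  let ?S = "Poly_Mapping.keys f \<union> Poly_Mapping.keys g"
  have *: "pairs_eval x h = (\<Sum>p\<in>?S. of_int (Poly_Mapping.lookup h p) * (x (fst p) * snd p))"
    if "Poly_Mapping.keys h \<subseteq> ?S" for h
    by (rule pairs_eval_superset) (use that in auto)
  show "pairs_eval x (f + g) = pairs_eval x f + pairs_eval x g"
    using *[of f] *[of g] *[of "f + g"] Poly_Mapping.keys_add[of f g]
    by (auto simp: lookup_add sum.distrib[symmetric] algebra_simps intro!: sum.cong)
  show "pairs_eval x (f - g) = pairs_eval x f - pairs_eval x g"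
    using *[of f] *[of g] *[of "f - g"] keys_diff[of f g]
    by (auto simp: lookup_minus sum_subtractf[symmetric] algebra_simps intro!: sum.cong)
qed (simp add: pairs_eval_def)

lemma pairs_eval_of [simp]: "pairs_eval x (frag_of (a, b)) = x a * b"
  by (simp add: pairs_eval_def)

locale Qbar_subfield =
  fixes F :: "complex set"
  assumes F: "subfield F CC" "F \<subseteq> Qbar"
begin

text \<open>On generators this is the multiplicativity of \<open>x\<close>; both sides are additive
  in \<open>f\<close> and in \<open>g\<close>.\<close>

lemma pairs_eval_mult:
  assumes x: "x \<in> embs F"
    and "Poly_Mapping.keys f \<subseteq> F \<times> Qbar" "Poly_Mapping.keys g \<subseteq> F \<times> Qbar"
  shows "pairs_eval x (pairs_mult f g) = pairs_eval x f * pairs_eval x g"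
proof (rule frag_induction[OF assms(2)])
  show "pairs_eval x (pairs_mult (frag_of p) g) = pairs_eval x (frag_of p) * pairs_eval x g"
    if "p \<in> F \<times> Qbar" for p
    by (rule frag_induction[OF assms(3)]; cases p)
      (use that embs_simps(3)[OF F(1) x] in \<open>auto simp: pairs_mult_linear pairs_eval_linear algebra_simps\<close>)
qed (auto simp: pairs_mult_linear pairs_eval_linear algebra_simps)

lemma pairs_eval_ring_hom:
  assumes x: "x \<in> embs F"
  shows "pairs_eval x \<in> ring_hom (free_pairs F Qbar) CC"
  by (rule ring_hom_memI)
    (use pairs_eval_mult[OF x] embs_simps(1)[OF F(1) x] in \<open>auto simp: free_pairs_simps pairs_eval_linear\<close>)

lemma pairs_eval_Qbar:
  assumes x: "x \<in> embs F" and "Poly_Mapping.keys f \<subseteq> F \<times> Qbar"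
  shows "pairs_eval x f \<in> Qbar"
  by (rule frag_induction[OF assms(2)])
    (use x subfield_CC_simps(5)[OF subfield_CC_Qbar] in \<open>auto simp: pairs_eval_linear embs_iff\<close>)

interpretation R: cring "free_pairs F Qbar"
  by (rule cring_free_pairs[OF F(1) subfield_CC_Qbar])

section \<open>The quotient ring and its coordinates\<close>

lemma tensor_relations_subset: "tensor_relations F Qbar \<subseteq> carrier (free_pairs F Qbar)"
proof -
  have "frag_of (a, b) \<in> carrier (free_pairs F Qbar)" if "a \<in> F" "b \<in> Qbar" for a b
    using that by (simp add: free_pairs_simps)
  moreover have "f - g \<in> carrier (free_pairs F Qbar)"
    if "f \<in> carrier (free_pairs F Qbar)" "g \<in> carrier (free_pairs F Qbar)" for f g
    using that keys_diff[of f g] by (auto simp: free_pairs_simps)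
  moreover have "q \<in> F" "q \<in> Qbar" if "q \<in> \<rat>" for q
    using that F Rats_subset_subfield by blast+
  ultimately show ?thesis
    using subfield_CC_simps[OF F(1)] by (auto simp: tensor_relations_def)
qed

lemma tensor_ideal: "ideal (tensor_ideal F Qbar) (free_pairs F Qbar)"
  unfolding tensor_ideal_def by (rule R.genideal_ideal[OF tensor_relations_subset])

lemma tensor_ring: "ring (tensor F Qbar)"
  unfolding tensor_def using tensor_ideal by (rule ideal.quotient_is_ring)

definition tensor_class :: "((complex \<times> complex) \<Rightarrow>\<^sub>0 int) \<Rightarrow> ((complex \<times> complex) \<Rightarrow>\<^sub>0 int) set" where
  "tensor_class f = tensor_ideal F Qbar +>\<^bsub>free_pairs F Qbar\<^esub> f"

lemma tensor_class_hom: "tensor_class \<in> ring_hom (free_pairs F Qbar) (tensor F Qbar)"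
  using ideal.rcos_ring_hom[OF tensor_ideal] by (simp add: tensor_class_def[abs_def] tensor_def)

lemma tensor_carrierE:
  assumes "t \<in> carrier (tensor F Qbar)"
  obtains f where "Poly_Mapping.keys f \<subseteq> F \<times> Qbar" "t = tensor_class f"
  using assms by (auto simp: tensor_def FactRing_def A_RCOSETS_def' tensor_class_def free_pairs_simps)

lemma pure_tensor_eq: "pure_tensor F Qbar a b = tensor_class (frag_of (a, b))"
  by (simp add: pure_tensor_def tensor_class_def)

text \<open>The kernel of evaluation is an ideal. It contains the relations because \<open>x\<close>
  is additive, multiplicative and the identity on rational numbers, hence it contains the ideal they
  generate.\<close>

lemma pairs_eval_tensor_ideal:
  assumes x: "x \<in> embs F" and "f \<in> tensor_ideal F Qbar"
  shows "pairs_eval x f = 0"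
proof -
  interpret ring_hom_ring "free_pairs F Qbar" CC "pairs_eval x"
    by (rule ring_hom_ringI2[OF R.ring_axioms CC.ring_axioms pairs_eval_ring_hom[OF x]])
  have Q: "q \<in> F" if "q \<in> \<rat>" for q using that F Rats_subset_subfield by blast
  have "pairs_eval x r = 0" if "r \<in> tensor_relations F Qbar" for r
    using that unfolding tensor_relations_def
  proof (elim UnE CollectE exE conjE)
    fix a a' b
    assume r: "r = frag_of (a + a', b) - frag_of (a, b) - frag_of (a', b)" and a: "a \<in> F" "a' \<in> F"
    show ?thesis
      unfolding r using embs_simps(2)[OF F(1) x a] by (simp add: pairs_eval_linear algebra_simps)
  next
    fix a b b' assume r: "r = frag_of (a, b + b') - frag_of (a, b) - frag_of (a, b')"
    show ?thesis unfolding r by (simp add: pairs_eval_linear algebra_simps)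
  next
    fix q a b assume r: "r = frag_of (q * a, b) - frag_of (a, q * b)" and q: "q \<in> \<rat>" and a: "a \<in> F"
    show ?thesis
      unfolding r using embs_simps(3)[OF F(1) x Q[OF q] a] embs_Rats[OF F(1) x q]
      by (simp add: pairs_eval_linear)
  qed
  then have "tensor_relations F Qbar \<subseteq> a_kernel (free_pairs F Qbar) CC (pairs_eval x)"
    using tensor_relations_subset unfolding a_kernel_def' CC_simps by blast
  then have "tensor_ideal F Qbar \<subseteq> a_kernel (free_pairs F Qbar) CC (pairs_eval x)"
    unfolding tensor_ideal_def by (rule R.genideal_minimal[OF kernel_is_ideal])
  then show ?thesis using assms(2) unfolding a_kernel_def' CC_simps by blast
qed

text \<open>Evaluation vanishes on the ideal, so it is constant on the coset and
  \<open>the_elem\<close> returns that constant.\<close>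

lemma tensor_coord_class:
  assumes x: "x \<in> embs F" and f: "Poly_Mapping.keys f \<subseteq> F \<times> Qbar"
  shows "tensor_coord (tensor_class f) x = pairs_eval x f"
proof -
  interpret I: ideal "tensor_ideal F Qbar" "free_pairs F Qbar" by (rule tensor_ideal)
  \<comment> \<open>A member of the ideal, so that the image of the coset is a singleton and not
    empty.\<close>
  have z: "0 \<in> tensor_ideal F Qbar" using I.zero_closed unfolding free_pairs_simps .
  have "tensor_class f = (\<lambda>h. h + f) ` tensor_ideal F Qbar"
    unfolding tensor_class_def a_r_coset_def' free_pairs_simps by blast
  then have "pairs_eval x ` tensor_class f = (\<lambda>h. pairs_eval x (h + f)) ` tensor_ideal F Qbar"
    by (simp only: image_image)
  also have "\<dots> = (\<lambda>h. pairs_eval x f) ` tensor_ideal F Qbar"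
    by (rule image_cong) (simp_all only: pairs_eval_linear pairs_eval_tensor_ideal[OF x] add_0)
  also have "\<dots> = {pairs_eval x f}" using z by (rule image_constant)
  finally have "pairs_eval x ` tensor_class f = {pairs_eval x f}" .
  moreover have "tensor_coord (tensor_class f) x = the_elem (pairs_eval x ` tensor_class f)"
    by (simp add: tensor_coord_def pairs_eval_def[abs_def])
  ultimately show ?thesis by simp
qed

lemma tensor_coord_Qbar:
  assumes "x \<in> embs F" "t \<in> carrier (tensor F Qbar)"
  shows "tensor_coord t x \<in> Qbar"
  using tensor_carrierE[OF assms(2)] tensor_coord_class[OF assms(1)] pairs_eval_Qbar[OF assms(1)]
  by metis

lemma pure_tensor_carrier: "a \<in> F \<Longrightarrow> b \<in> Qbar \<Longrightarrow> pure_tensor F Qbar a b \<in> carrier (tensor F Qbar)"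
  unfolding pure_tensor_eq using ring_hom_closed[OF tensor_class_hom, of "frag_of (a, b)"]
  by (simp add: free_pairs_simps)

lemma tensor_coord_pure:
  "x \<in> embs F \<Longrightarrow> a \<in> F \<Longrightarrow> b \<in> Qbar \<Longrightarrow> tensor_coord (pure_tensor F Qbar a b) x = x a * b"
  unfolding pure_tensor_eq by (simp add: tensor_coord_class)

lemma tensor_coord_ring_hom:
  assumes x: "x \<in> embs F"
  shows "(\<lambda>t. tensor_coord t x) \<in> ring_hom (tensor F Qbar) CC"
proof (rule ring_hom_memI)
  have C: "tensor_coord (tensor_class f) x = pairs_eval x f" if "f \<in> carrier (free_pairs F Qbar)" for f
    using tensor_coord_class[OF x] that by (simp add: free_pairs_simps)
  note E = ring_hom_mult[OF pairs_eval_ring_hom[OF x]] ring_hom_add[OF pairs_eval_ring_hom[OF x]]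
  fix t u assume "t \<in> carrier (tensor F Qbar)" "u \<in> carrier (tensor F Qbar)"
  then obtain f g where f: "f \<in> carrier (free_pairs F Qbar)" "t = tensor_class f"
    and g: "g \<in> carrier (free_pairs F Qbar)" "u = tensor_class g"
    by (metis tensor_carrierE free_pairs_simps(1) mem_Collect_eq)
  show "tensor_coord (t \<otimes>\<^bsub>tensor F Qbar\<^esub> u) x = tensor_coord t x \<otimes>\<^bsub>CC\<^esub> tensor_coord u x"
    using ring_hom_mult[OF tensor_class_hom f(1) g(1)] E(1)[OF f(1) g(1)] C[OF f(1)] C[OF g(1)]
      C[OF R.m_closed[OF f(1) g(1)]] f(2) g(2) by simp
  show "tensor_coord (t \<oplus>\<^bsub>tensor F Qbar\<^esub> u) x = tensor_coord t x \<oplus>\<^bsub>CC\<^esub> tensor_coord u x"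
    using ring_hom_add[OF tensor_class_hom f(1) g(1)] E(2)[OF f(1) g(1)] C[OF f(1)] C[OF g(1)]
      C[OF R.a_closed[OF f(1) g(1)]] f(2) g(2) by simp
next
  show "tensor_coord \<one>\<^bsub>tensor F Qbar\<^esub> x = \<one>\<^bsub>CC\<^esub>"
    using ring_hom_one[OF tensor_class_hom] ring_hom_one[OF pairs_eval_ring_hom[OF x]]
      tensor_coord_class[OF x, of "frag_of (1, 1)"] subfield_CC_simps(2)[OF F(1)]
    by (simp add: free_pairs_simps)
qed simp

lemma pure_tensor_mult:
  assumes "a \<in> F" "b \<in> Qbar" "a' \<in> F" "b' \<in> Qbar"
  shows "pure_tensor F Qbar a b \<otimes>\<^bsub>tensor F Qbar\<^esub> pure_tensor F Qbar a' b' = pure_tensor F Qbar (a * a') (b * b')"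
  using ring_hom_mult[OF tensor_class_hom, of "frag_of (a, b)" "frag_of (a', b')"] assms
  by (simp add: pure_tensor_eq free_pairs_simps)

lemma pure_tensor_one: "pure_tensor F Qbar 1 1 = \<one>\<^bsub>tensor F Qbar\<^esub>"
  using ring_hom_one[OF tensor_class_hom] by (simp add: pure_tensor_eq free_pairs_simps)

text \<open>The corresponding relation lies in the ideal and has class zero. This supplies the
  additivity of \<open>aut_gal\<close>.\<close>

lemma pure_tensor_add:
  assumes "a \<in> F" "b \<in> Qbar" "b' \<in> Qbar"
  shows "pure_tensor F Qbar a (b + b') = pure_tensor F Qbar a b \<oplus>\<^bsub>tensor F Qbar\<^esub> pure_tensor F Qbar a b'"
proof -
  interpret I: ideal "tensor_ideal F Qbar" "free_pairs F Qbar" by (rule tensor_ideal)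
  interpret T: ring "tensor F Qbar" by (rule tensor_ring)
  let ?r = "frag_of (a, b + b') - frag_of (a, b) - frag_of (a, b')"
  have "?r \<in> tensor_relations F Qbar" using assms unfolding tensor_relations_def by blast
  then have r: "?r \<in> tensor_ideal F Qbar"
    unfolding tensor_ideal_def using R.genideal_self[OF tensor_relations_subset] by blast
  then have rc: "?r \<in> carrier (free_pairs F Qbar)" using I.Icarr by blast
  have z: "tensor_class ?r = \<zero>\<^bsub>tensor F Qbar\<^esub>"
    unfolding tensor_class_def I.a_rcos_const[OF r] by (simp add: tensor_def FactRing_def)
  have c: "frag_of (a, b) \<in> carrier (free_pairs F Qbar)" "frag_of (a, b') \<in> carrier (free_pairs F Qbar)"
    using assms by (simp_all add: free_pairs_simps)
  note ad = ring_hom_add[OF tensor_class_hom]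
  have "tensor_class (frag_of (a, b + b'))
      = tensor_class (?r \<oplus>\<^bsub>free_pairs F Qbar\<^esub> (frag_of (a, b) \<oplus>\<^bsub>free_pairs F Qbar\<^esub> frag_of (a, b')))"
    by (simp add: free_pairs_simps)
  also have "\<dots> = tensor_class ?r \<oplus>\<^bsub>tensor F Qbar\<^esub>
      (tensor_class (frag_of (a, b)) \<oplus>\<^bsub>tensor F Qbar\<^esub> tensor_class (frag_of (a, b')))"
    using ad[OF rc R.a_closed[OF c]] ad[OF c] by simp
  also have "\<dots> = tensor_class (frag_of (a, b)) \<oplus>\<^bsub>tensor F Qbar\<^esub> tensor_class (frag_of (a, b'))"
    unfolding z using ring_hom_closed[OF tensor_class_hom] c by (intro T.l_zero T.a_closed) auto
  finally show ?thesis by (simp add: pure_tensor_eq)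
qed

text \<open>Every pure tensor is a product of one with second entry 1 and one with first entry 1,
  and the pure tensors generate the tensor product additively.\<close>

lemma tensor_hom_eqI:
  assumes \<phi>: "\<phi> \<in> ring_hom (tensor F Qbar) CC" and \<psi>: "\<psi> \<in> ring_hom (tensor F Qbar) CC"
    and F_eq: "\<And>a. a \<in> F \<Longrightarrow> \<phi> (pure_tensor F Qbar a 1) = \<psi> (pure_tensor F Qbar a 1)"
    and Q_eq: "\<And>b. b \<in> Qbar \<Longrightarrow> \<phi> (pure_tensor F Qbar 1 b) = \<psi> (pure_tensor F Qbar 1 b)"
    and t: "t \<in> carrier (tensor F Qbar)"
  shows "\<phi> t = \<psi> t"
proof -
  obtain f where f: "Poly_Mapping.keys f \<subseteq> F \<times> Qbar" "t = tensor_class f" using tensor_carrierE[OF t] .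
  have one: "1 \<in> F" using subfield_CC_simps(2)[OF F(1)] .
  \<comment> \<open>The support condition is carried along so that the difference step may apply
    additivity to \<open>u - v\<close> and \<open>v\<close>.\<close>
  have "Poly_Mapping.keys f \<subseteq> F \<times> Qbar \<and> \<phi> (tensor_class f) = \<psi> (tensor_class f)"
  proof (rule frag_induction[OF f(1)], goal_cases)
    case 1
    have "\<chi> (tensor_class 0) = 0" if "\<chi> \<in> ring_hom (tensor F Qbar) CC" for \<chi>
      using ring_hom_zero[OF ring_hom_trans[OF tensor_class_hom that] R.ring_axioms CC.ring_axioms]
      by (simp add: free_pairs_simps)
    from this[OF \<phi>] this[OF \<psi>] show ?case by simp
  next
    case (2 p)
    then obtain a b where p: "p = (a, b)" "a \<in> F" "b \<in> Qbar" by auto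
    have "\<chi> (pure_tensor F Qbar a b) = \<chi> (pure_tensor F Qbar a 1) * \<chi> (pure_tensor F Qbar 1 b)"
      if "\<chi> \<in> ring_hom (tensor F Qbar) CC" for \<chi>
      using ring_hom_mult[OF that, of "pure_tensor F Qbar a 1" "pure_tensor F Qbar 1 b"]
        pure_tensor_mult[of a 1 1 b] p one by (simp add: pure_tensor_carrier)
    from this[OF \<phi>] this[OF \<psi>] show ?case
      using F_eq[OF p(2)] Q_eq[OF p(3)] p by (simp add: pure_tensor_eq)
  next
    case (3 u v)
    have d: "Poly_Mapping.keys (u - v) \<subseteq> F \<times> Qbar" using 3 keys_diff[of u v] by blast
    have "\<chi> (tensor_class u) = \<chi> (tensor_class (u - v)) + \<chi> (tensor_class v)"
      if "\<chi> \<in> ring_hom (tensor F Qbar) CC" for \<chi>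
      using ring_hom_add[OF ring_hom_trans[OF tensor_class_hom that], of "u - v" v] d 3
      by (simp add: free_pairs_simps)
    from this[OF \<phi>] this[OF \<psi>] show ?case using d 3 by simp
  qed
  then show ?thesis using f(2) by simp
qed

end

section \<open>Automorphisms of the tensor product\<close>

context Qbar_subfield
begin

lemma F_autsD:
  assumes "g \<in> F_auts F"
  shows "g \<in> ring_hom (tensor F Qbar) (tensor F Qbar)" "g \<in> Bij (carrier (tensor F Qbar))"
    "a \<in> F \<Longrightarrow> g (pure_tensor F Qbar a 1) = pure_tensor F Qbar a 1"
    "t \<in> carrier (tensor F Qbar) \<Longrightarrow> g t \<in> carrier (tensor F Qbar)"
  using assms ring_hom_closed by (auto simp: F_auts_def)

definition aut_gal where
  "aut_gal g x = (\<lambda>b\<in>Qbar. tensor_coord (g (pure_tensor F Qbar 1 b)) x)"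

text \<open>The coordinate of \<open>t\<close> from which coordinate \<open>x\<close> of
  \<open>g t\<close> is computed, that is, the inverse of the permutation \<open>\<pi>\<close> at
  \<open>x\<close>.\<close>

definition aut_src where
  "aut_src g x = compose F (inv\<^bsub>\<Gamma>Q\<^esub> (aut_gal g x)) x"

context
  fixes g assumes g: "g \<in> F_auts F"
begin

lemma aut_coord_hom:
  "x \<in> embs F \<Longrightarrow> (\<lambda>t. tensor_coord (g t) x) \<in> ring_hom (tensor F Qbar) CC"
  using ring_hom_trans[OF F_autsD(1)[OF g] tensor_coord_ring_hom] by (simp add: comp_def)

text \<open>A composite of ring homomorphisms, read on the second tensor factor; bijectivity comes
  for free from \<open>\<Gamma>Q_iff_embs\<close>.\<close>

lemma aut_gal_\<Gamma>Q:
  assumes x: "x \<in> embs F"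
  shows "aut_gal g x \<in> carrier \<Gamma>Q"
  unfolding \<Gamma>Q_iff_embs embs_iff
proof (intro conjI ballI)
  note \<phi> = aut_coord_hom[OF x]
  have one: "1 \<in> F" using subfield_CC_simps(2)[OF F(1)] .
  show "aut_gal g x 1 = 1"
    using ring_hom_one[OF \<phi>] by (simp add: aut_gal_def pure_tensor_one)
  fix b assume b: "b \<in> Qbar"
  then show "aut_gal g x b \<in> Qbar"
    using tensor_coord_Qbar[OF x F_autsD(4)[OF g pure_tensor_carrier[OF one b]]] by (simp add: aut_gal_def)
  fix b' assume b': "b' \<in> Qbar"
  show "aut_gal g x (b + b') = aut_gal g x b + aut_gal g x b'"
    using ring_hom_add[OF \<phi> pure_tensor_carrier[OF one b] pure_tensor_carrier[OF one b']]
      pure_tensor_add[OF one b b'] b b' by (simp add: aut_gal_def)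
  show "aut_gal g x (b * b') = aut_gal g x b * aut_gal g x b'"
    using ring_hom_mult[OF \<phi> pure_tensor_carrier[OF one b] pure_tensor_carrier[OF one b']]
      pure_tensor_mult[OF one b one b'] b b' by (simp add: aut_gal_def)
qed (simp add: aut_gal_def)

lemma aut_src_embs:
  assumes x: "x \<in> embs F"
  shows "aut_src g x \<in> embs F"
  unfolding aut_src_def
  using embs_compose[OF x _ F(1)] \<Gamma>Q.inv_closed[OF aut_gal_\<Gamma>Q[OF x]] by (simp add: \<Gamma>Q_iff_embs)

lemma aut_gal_src:
  assumes x: "x \<in> embs F" and a: "a \<in> F"
  shows "aut_gal g x (aut_src g x a) = x a"
  using \<Gamma>Q_inv_apply(2)[OF aut_gal_\<Gamma>Q[OF x], of "x a"] embs_simps(4)[OF F(1) x a] a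
  by (simp add: aut_src_def compose_eq)

text \<open>
  Both sides are ring homomorphisms on \<open>F \<otimes> Qbar\<close>, and they agree on \<open>a \<otimes> 1\<close> because \<open>g\<close>
  fixes \<open>a \<otimes> 1\<close>, and on \<open>1 \<otimes> b\<close> by definition of \<open>aut_gal\<close>.
\<close>

lemma tensor_coord_aut:
  assumes x: "x \<in> embs F" and t: "t \<in> carrier (tensor F Qbar)"
  shows "tensor_coord (g t) x = aut_gal g x (tensor_coord t (aut_src g x))"
proof (rule tensor_hom_eqI[where \<psi> = "\<lambda>t. aut_gal g x (tensor_coord t (aut_src g x))",
    OF aut_coord_hom[OF x] _ _ _ t])
  have gal: "aut_gal g x \<in> embs Qbar" using aut_gal_\<Gamma>Q[OF x] by (simp add: \<Gamma>Q_iff_embs)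
  note G = embs_simps[OF subfield_CC_Qbar gal]
  note y = aut_src_embs[OF x]
  note \<phi> = tensor_coord_ring_hom[OF y]
  note Q = tensor_coord_Qbar[OF y]
  show "(\<lambda>t. aut_gal g x (tensor_coord t (aut_src g x))) \<in> ring_hom (tensor F Qbar) CC"
  proof (rule ring_hom_memI)
    fix t u assume t: "t \<in> carrier (tensor F Qbar)" "u \<in> carrier (tensor F Qbar)"
    show "aut_gal g x (tensor_coord (t \<otimes>\<^bsub>tensor F Qbar\<^esub> u) (aut_src g x)) =
      aut_gal g x (tensor_coord t (aut_src g x)) \<otimes>\<^bsub>CC\<^esub> aut_gal g x (tensor_coord u (aut_src g x))"
      using ring_hom_mult[OF \<phi> t] G(3)[OF Q[OF t(1)] Q[OF t(2)]] by simp
    show "aut_gal g x (tensor_coord (t \<oplus>\<^bsub>tensor F Qbar\<^esub> u) (aut_src g x)) =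
      aut_gal g x (tensor_coord t (aut_src g x)) \<oplus>\<^bsub>CC\<^esub> aut_gal g x (tensor_coord u (aut_src g x))"
      using ring_hom_add[OF \<phi> t] G(2)[OF Q[OF t(1)] Q[OF t(2)]] by simp
  next
    show "aut_gal g x (tensor_coord \<one>\<^bsub>tensor F Qbar\<^esub> (aut_src g x)) = \<one>\<^bsub>CC\<^esub>"
      using ring_hom_one[OF \<phi>] G(1) by simp
  qed simp
  show "tensor_coord (g (pure_tensor F Qbar a 1)) x
      = aut_gal g x (tensor_coord (pure_tensor F Qbar a 1) (aut_src g x))" if "a \<in> F" for a
    using F_autsD(3)[OF g that] tensor_coord_pure[OF x that] tensor_coord_pure[OF y that]
      aut_gal_src[OF x that] by simp
  show "tensor_coord (g (pure_tensor F Qbar 1 b)) x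
      = aut_gal g x (tensor_coord (pure_tensor F Qbar 1 b) (aut_src g x))" if "b \<in> Qbar" for b
    using tensor_coord_pure[OF y _ that, of 1] subfield_CC_simps(2)[OF F(1)] that
      embs_simps(1)[OF F(1) y] by (simp add: aut_gal_def)
qed

end

text \<open>The inverse automorphism will induce the inverse map on embeddings, which gives the
  bijectivity of \<open>aut_src\<close>.\<close>

lemma F_auts_inverse:
  assumes g: "g \<in> F_auts F"
  obtains g' where "g' \<in> F_auts F" "\<And>t. t \<in> carrier (tensor F Qbar) \<Longrightarrow> g' (g t) = t"
    "\<And>t. t \<in> carrier (tensor F Qbar) \<Longrightarrow> g (g' t) = t"
proof -
  let ?C = "carrier (tensor F Qbar)"
  interpret T: ring "tensor F Qbar" by (rule tensor_ring)
  have bij: "bij_betw g ?C ?C" using F_autsD(2)[OF g] by (simp add: Bij_def)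
  define g' where "g' = restrict (inv_into ?C g) ?C"
  have inv: "t \<in> ?C \<Longrightarrow> g' (g t) = t" "t \<in> ?C \<Longrightarrow> g (g' t) = t" "t \<in> ?C \<Longrightarrow> g' t \<in> ?C" for t
    using bij_betw_inv_into_left[OF bij] bij_betw_inv_into_right[OF bij] F_autsD(4)[OF g]
      bij_betw_imp_surj_on[OF bij] by (auto simp: g'_def inv_into_into)
  have "g' \<in> Bij ?C" unfolding g'_def by (rule restrict_inv_into_Bij[OF F_autsD(2)[OF g]])
  moreover have "g' \<in> ring_hom (tensor F Qbar) (tensor F Qbar)"
  proof (rule ring_hom_memI)
    fix t u assume t: "t \<in> ?C" and u: "u \<in> ?C"
    show "g' t \<in> ?C" using inv(3)[OF t] .
    have "g (g' t \<otimes>\<^bsub>tensor F Qbar\<^esub> g' u) = t \<otimes>\<^bsub>tensor F Qbar\<^esub> u"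
      "g (g' t \<oplus>\<^bsub>tensor F Qbar\<^esub> g' u) = t \<oplus>\<^bsub>tensor F Qbar\<^esub> u"
      using ring_hom_mult[OF F_autsD(1)[OF g] inv(3)[OF t] inv(3)[OF u]]
        ring_hom_add[OF F_autsD(1)[OF g] inv(3)[OF t] inv(3)[OF u]] inv(2)[OF t] inv(2)[OF u] by simp_all
    then show "g' (t \<otimes>\<^bsub>tensor F Qbar\<^esub> u) = g' t \<otimes>\<^bsub>tensor F Qbar\<^esub> g' u"
      "g' (t \<oplus>\<^bsub>tensor F Qbar\<^esub> u) = g' t \<oplus>\<^bsub>tensor F Qbar\<^esub> g' u"
      using inv(1) inv(3)[OF t] inv(3)[OF u] T.m_closed T.a_closed by metis+
  next
    show "g' \<one>\<^bsub>tensor F Qbar\<^esub> = \<one>\<^bsub>tensor F Qbar\<^esub>"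
      using inv(1)[OF T.one_closed] ring_hom_one[OF F_autsD(1)[OF g]] by simp
  qed
  moreover have "g' (pure_tensor F Qbar a 1) = pure_tensor F Qbar a 1" if "a \<in> F" for a
    using inv(1)[OF pure_tensor_carrier[OF that Qbar_closed(2)]] F_autsD(3)[OF g that] by simp
  ultimately have "g' \<in> F_auts F" by (simp add: F_auts_def)
  with inv show thesis using that by blast
qed

text \<open>Two applications of \<open>tensor_coord_aut\<close> express a coordinate of
  \<open>t\<close> through another one. Testing on pure tensors with first entry 1 shows that the
  two Galois elements cancel; testing on those with second entry 1 then identifies the
  embeddings.\<close>

lemma aut_src_aut_src:
  assumes g: "g \<in> F_auts F" and g': "g' \<in> F_auts F"
    and inv: "\<And>t. t \<in> carrier (tensor F Qbar) \<Longrightarrow> g' (g t) = t" and x: "x \<in> embs F"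
  shows "aut_src g (aut_src g' x) = x"
proof (rule embs_eqI)
  let ?y = "aut_src g' x"
  have y: "?y \<in> embs F" by (rule aut_src_embs[OF g' x])
  show z: "aut_src g ?y \<in> embs F" by (rule aut_src_embs[OF g y])
  have eq: "tensor_coord t x = aut_gal g' x (aut_gal g ?y (tensor_coord t (aut_src g ?y)))"
    if t: "t \<in> carrier (tensor F Qbar)" for t
    using tensor_coord_aut[OF g' x F_autsD(4)[OF g t]] tensor_coord_aut[OF g y t] inv[OF t] by simp
  have one: "1 \<in> F" using subfield_CC_simps(2)[OF F(1)] .
  have id: "b = aut_gal g' x (aut_gal g ?y b)" if b: "b \<in> Qbar" for b
    using eq[OF pure_tensor_carrier[OF one b]] tensor_coord_pure[OF x one b] tensor_coord_pure[OF z one b]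
      embs_simps(1)[OF F(1) x] embs_simps(1)[OF F(1) z] by simp
  fix a assume a: "a \<in> F"
  have "x a = aut_gal g' x (aut_gal g ?y (aut_src g ?y a))"
    using eq[OF pure_tensor_carrier[OF a Qbar_closed(2)]] tensor_coord_pure[OF x a Qbar_closed(2)]
      tensor_coord_pure[OF z a Qbar_closed(2)] by simp
  then show "aut_src g ?y a = x a"
    using id[OF embs_simps(4)[OF F(1) z a]] by simp
qed (rule x)

section \<open>The permutation and the twists of an automorphism\<close>

definition aut_perm where
  "aut_perm g = (\<lambda>x\<in>embs F. inv_into (embs F) (aut_src g) x)"

text \<open>The solution for \<open>h x\<close> of
  \<open>s (\<pi> x) (h x z) = \<sigma> (s x z)\<close>, where \<open>\<sigma>\<close> is the Galois
  element at \<open>\<pi> x\<close>.\<close>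

definition aut_twist where
  "aut_twist g s = (\<lambda>x\<in>embs F. inv\<^bsub>\<Gamma>Q\<^esub> (s (aut_perm g x)) \<otimes>\<^bsub>\<Gamma>Q\<^esub> aut_gal g (aut_perm g x) \<otimes>\<^bsub>\<Gamma>Q\<^esub> s x)"

lemma aut_src_bij:
  assumes g: "g \<in> F_auts F"
  shows "bij_betw (aut_src g) (embs F) (embs F)"
proof -
  obtain g' where g': "g' \<in> F_auts F" "\<And>t. t \<in> carrier (tensor F Qbar) \<Longrightarrow> g' (g t) = t"
    "\<And>t. t \<in> carrier (tensor F Qbar) \<Longrightarrow> g (g' t) = t"
    using F_auts_inverse[OF g] by blast
  show ?thesis
  proof (rule bij_betwI[where g = "aut_src g'"])
    show "aut_src g \<in> embs F \<rightarrow> embs F" using aut_src_embs[OF g] by blast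
    show "aut_src g' \<in> embs F \<rightarrow> embs F" using aut_src_embs[OF g'(1)] by blast
    show "aut_src g' (aut_src g x) = x" if "x \<in> embs F" for x
      by (rule aut_src_aut_src[OF g'(1) g g'(3) that])
    show "aut_src g (aut_src g' x) = x" if "x \<in> embs F" for x
      by (rule aut_src_aut_src[OF g g'(1) g'(2) that])
  qed
qed

context
  fixes g assumes g: "g \<in> F_auts F"
begin

lemma aut_perm_Bij: "aut_perm g \<in> Bij (embs F)"
  using bij_betw_inv_into[OF aut_src_bij[OF g]] unfolding Bij_def aut_perm_def by simp

lemma aut_perm_embs:
  assumes x: "x \<in> embs F"
  shows "aut_perm g x \<in> embs F" "aut_src g (aut_perm g x) = x" "aut_perm g (aut_src g x) = x"
  using bij_betw_inv_into_right[OF aut_src_bij[OF g] x] bij_betw_inv_into_left[OF aut_src_bij[OF g] x]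
    bij_betwE[OF bij_betw_inv_into[OF aut_src_bij[OF g]]] x aut_src_embs[OF g x]
  by (auto simp: aut_perm_def)

lemma aut_gal_perm:
  assumes x: "x \<in> embs F" and a: "a \<in> F"
  shows "aut_gal g (aut_perm g x) (x a) = aut_perm g x a"
  using aut_gal_src[OF g aut_perm_embs(1)[OF x] a] aut_perm_embs(2)[OF x] by simp

text \<open>Both \<open>s (\<pi> x)\<close> and \<open>\<sigma>\<close> times \<open>s x\<close>
  restrict to \<open>\<pi> x\<close> on \<open>F\<close>, so their quotient fixes
  \<open>F\<close>.\<close>

lemma aut_twist_\<Gamma>F:
  assumes s: "coset_reps F s" and x: "x \<in> embs F"
  shows "aut_twist g s x \<in> carrier (\<Gamma> F)"
proof -
  note sx = coset_repsD[OF s x] and sp = coset_repsD[OF s aut_perm_embs(1)[OF x]]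
  note gal = aut_gal_\<Gamma>Q[OF g aut_perm_embs(1)[OF x]]
  have "restrict (s (aut_perm g x)) F = restrict (aut_gal g (aut_perm g x) \<otimes>\<^bsub>\<Gamma>Q\<^esub> s x) F"
  proof (rule restrict_ext)
    fix a assume a: "a \<in> F"
    then have "a \<in> Qbar" using F(2) by blast
    then show "s (aut_perm g x) a = (aut_gal g (aut_perm g x) \<otimes>\<^bsub>\<Gamma>Q\<^esub> s x) a"
      using sx(3)[OF a] sp(3)[OF a] aut_gal_perm[OF x a] gal sx(1) by simp
  qed
  then show ?thesis
    using restrict_eq_iff_inv_mult[OF sp(1) \<Gamma>Q.m_closed[OF gal sx(1)] F(2)] x gal sx(1) sp(1)
    by (simp add: aut_twist_def \<Gamma>Q.m_assoc)
qed

text \<open>Existence is \<open>tensor_coord_aut\<close> rewritten in the coordinates given by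
  \<open>s\<close>. For uniqueness, any admissible pair is tested on the two kinds of pure
  tensors.\<close>

lemma beta_eq:
  assumes s: "coset_reps F s"
  shows "beta F s g = (aut_perm g, aut_twist g s)"
  unfolding beta_def
proof (rule the_equality, goal_cases)
  case 1
  have "b (aut_perm g x) = aut_twist g s x (a x)"
    if t: "t \<in> carrier (tensor F Qbar)" and a: "a \<in> embs F \<rightarrow>\<^sub>E Qbar" and b: "b \<in> embs F \<rightarrow>\<^sub>E Qbar"
      and ta: "\<forall>x\<in>embs F. tensor_coord t x = s x (a x)"
      and gb: "\<forall>x\<in>embs F. tensor_coord (g t) x = s x (b x)" and x: "x \<in> embs F" for t a b x
  proof -
    note p = aut_perm_embs(1)[OF x]
    note sx = coset_repsD[OF s x] and sp = coset_repsD[OF s p] and gal = aut_gal_\<Gamma>Q[OF g p]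
    have Q: "a x \<in> Qbar" "b (aut_perm g x) \<in> Qbar" using a b x p by auto
    have "s (aut_perm g x) (b (aut_perm g x)) = aut_gal g (aut_perm g x) (s x (a x))"
      using tensor_coord_aut[OF g p t] aut_perm_embs(2)[OF x] ta x gb p by simp
    then have "b (aut_perm g x) = (inv\<^bsub>\<Gamma>Q\<^esub> (s (aut_perm g x))) (aut_gal g (aut_perm g x) (s x (a x)))"
      using \<Gamma>Q_inv_apply(1)[OF sp(1) Q(2)] by simp
    then show ?thesis using Q gal sx(1) sp(1) x by (simp add: aut_twist_def)
  qed
  moreover have "aut_twist g s \<in> embs F \<rightarrow>\<^sub>E carrier (\<Gamma> F)"
    using aut_twist_\<Gamma>F[OF s] by (simp add: PiE_def aut_twist_def)
  ultimately show ?case using aut_perm_Bij by simp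
next
  case (2 ph)
  obtain \<pi> h where ph: "ph = (\<pi>, h)" by (cases ph)
  have \<pi>: "\<pi> \<in> Bij (embs F)" and h: "h \<in> embs F \<rightarrow>\<^sub>E carrier (\<Gamma> F)"
    and eq: "\<And>t a b x. t \<in> carrier (tensor F Qbar) \<Longrightarrow> a \<in> embs F \<rightarrow>\<^sub>E Qbar \<Longrightarrow> b \<in> embs F \<rightarrow>\<^sub>E Qbar \<Longrightarrow>
        \<forall>x\<in>embs F. tensor_coord t x = s x (a x) \<Longrightarrow> \<forall>x\<in>embs F. tensor_coord (g t) x = s x (b x) \<Longrightarrow>
        x \<in> embs F \<Longrightarrow> b (\<pi> x) = h x (a x)"
    using 2 unfolding ph by auto
  have one: "1 \<in> F" using subfield_CC_simps(2)[OF F(1)] .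
  have *: "\<pi> x = aut_perm g x" "h x = aut_twist g s x" if x: "x \<in> embs F" for x
  proof -
    have p: "\<pi> x \<in> embs F" using \<pi> x Bij_imp_funcset by blast
    note sx = coset_repsD[OF s x] and sp = coset_repsD[OF s p] and gal = aut_gal_\<Gamma>Q[OF g p]
    have hx: "h x \<in> carrier \<Gamma>Q" using h x carrier_\<Gamma>_subset[of F] by auto
    have main: "tensor_coord (g t) (\<pi> x) = s (\<pi> x) (h x ((inv\<^bsub>\<Gamma>Q\<^esub> (s x)) (tensor_coord t x)))"
      if t: "t \<in> carrier (tensor F Qbar)" for t
    proof -
      \<comment> \<open>The defining condition speaks about families \<open>a\<close> and
        \<open>b\<close> presented through \<open>s\<close>; solving
        \<open>tensor_coord t y = s y (a y)\<close>, and likewise for \<open>g t\<close>, provides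
        them for any given \<open>t\<close>.\<close>
      define a where "a = (\<lambda>x\<in>embs F. (inv\<^bsub>\<Gamma>Q\<^esub> (s x)) (tensor_coord t x))"
      define b where "b = (\<lambda>x\<in>embs F. (inv\<^bsub>\<Gamma>Q\<^esub> (s x)) (tensor_coord (g t) x))"
      have Q: "tensor_coord t y \<in> Qbar" "tensor_coord (g t) y \<in> Qbar" "s y \<in> carrier \<Gamma>Q"
        if "y \<in> embs F" for y
        using tensor_coord_Qbar[OF that] t F_autsD(4)[OF g t] coset_repsD(1)[OF s that] by auto
      have "b (\<pi> x) = h x (a x)"
        by (rule eq[OF t _ _ _ _ x]) (use Q in \<open>auto simp: a_def b_def\<close>)
      then have "(inv\<^bsub>\<Gamma>Q\<^esub> (s (\<pi> x))) (tensor_coord (g t) (\<pi> x)) = h x ((inv\<^bsub>\<Gamma>Q\<^esub> (s x)) (tensor_coord t x))"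
        using x p by (simp add: a_def b_def)
      then show ?thesis using \<Gamma>Q_inv_apply(2)[OF sp(1) Q(2)[OF p]] by simp
    qed
    \<comment> \<open>Tensors with first entry 1 express the Galois element at
      \<open>\<pi> x\<close> through \<open>h x\<close>. Tensors with second entry 1, which
      \<open>g\<close> fixes, then give the source of \<open>\<pi> x\<close>, and so
      \<open>\<pi> x\<close> itself.\<close>
    have G: "aut_gal g (\<pi> x) b = s (\<pi> x) (h x ((inv\<^bsub>\<Gamma>Q\<^esub> (s x)) b))" if b: "b \<in> Qbar" for b
      using main[OF pure_tensor_carrier[OF one b]] tensor_coord_pure[OF x one b]
        embs_simps(1)[OF F(1) x] b by (simp add: aut_gal_def)
    have "aut_src g (\<pi> x) = x"
    proof (rule embs_eqI[OF aut_src_embs[OF g p] x])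
      fix a assume a: "a \<in> F"
      have xa: "x a \<in> Qbar" by (rule embs_simps(4)[OF F(1) x a])
      have "\<pi> x a = aut_gal g (\<pi> x) (x a)"
        using main[OF pure_tensor_carrier[OF a Qbar_closed(2)]] F_autsD(3)[OF g a]
          tensor_coord_pure[OF x a Qbar_closed(2)] tensor_coord_pure[OF p a Qbar_closed(2)] G[OF xa] by simp
      then show "aut_src g (\<pi> x) a = x a"
        using \<Gamma>Q_inv_apply(1)[OF gal xa] a by (simp add: aut_src_def compose_eq)
    qed
    then show \<pi>x: "\<pi> x = aut_perm g x" using aut_perm_embs(3)[OF p] by simp
    have "h x = inv\<^bsub>\<Gamma>Q\<^esub> (s (\<pi> x)) \<otimes>\<^bsub>\<Gamma>Q\<^esub> aut_gal g (\<pi> x) \<otimes>\<^bsub>\<Gamma>Q\<^esub> s x"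
    proof (rule \<Gamma>Q_eqI[OF hx])
      fix z assume z: "z \<in> Qbar"
      then show "h x z = (inv\<^bsub>\<Gamma>Q\<^esub> (s (\<pi> x)) \<otimes>\<^bsub>\<Gamma>Q\<^esub> aut_gal g (\<pi> x) \<otimes>\<^bsub>\<Gamma>Q\<^esub> s x) z"
        using G[of "s x z"] sx(1) sp(1) gal hx by simp
    qed (use sx(1) sp(1) gal in simp)
    then show "h x = aut_twist g s x" using \<pi>x x by (simp add: aut_twist_def)
  qed
  have "\<pi> = aut_perm g"
    by (rule extensionalityI[OF Bij_imp_extensional[OF \<pi>] Bij_imp_extensional[OF aut_perm_Bij]]) (rule *)
  moreover have "h = aut_twist g s"
    by (rule extensionalityI[of _ "embs F"]) (use h * in \<open>auto simp: PiE_def aut_twist_def\<close>)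
  ultimately show ?case by (simp add: ph)
qed

end

end

section \<open>The canonical isomorphism\<close>

lemma plecticD:
  assumes "\<alpha> \<in> carrier (plectic \<Gamma>Q H)"
  shows "\<alpha> \<in> Bij (carrier \<Gamma>Q)" "\<sigma> \<in> carrier \<Gamma>Q \<Longrightarrow> \<alpha> \<sigma> \<in> carrier \<Gamma>Q"
    "\<sigma> \<in> carrier \<Gamma>Q \<Longrightarrow> \<kappa> \<in> H \<Longrightarrow> \<alpha> (\<sigma> \<otimes>\<^bsub>\<Gamma>Q\<^esub> \<kappa>) = \<alpha> \<sigma> \<otimes>\<^bsub>\<Gamma>Q\<^esub> \<kappa>"
proof -
  show B: "\<alpha> \<in> Bij (carrier \<Gamma>Q)" using assms by (simp add: plectic_def)
  show "\<sigma> \<in> carrier \<Gamma>Q \<Longrightarrow> \<alpha> \<sigma> \<in> carrier \<Gamma>Q" using Bij_imp_funcset[OF B] by blast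
  show "\<sigma> \<in> carrier \<Gamma>Q \<Longrightarrow> \<kappa> \<in> H \<Longrightarrow> \<alpha> (\<sigma> \<otimes>\<^bsub>\<Gamma>Q\<^esub> \<kappa>) = \<alpha> \<sigma> \<otimes>\<^bsub>\<Gamma>Q\<^esub> \<kappa>"
    using assms by (simp add: plectic_def)
qed

lemma plectic_antimono: "H' \<subseteq> H \<Longrightarrow> carrier (plectic G H) \<subseteq> carrier (plectic G H')"
  by (auto simp: plectic_def)

lemma lift_factor:
  assumes "\<sigma> \<in> carrier \<Gamma>Q" "\<tau> \<in> carrier \<Gamma>Q" "restrict \<sigma> L = restrict \<tau> L" "L \<subseteq> Qbar"
  obtains \<kappa> where "\<kappa> \<in> carrier (\<Gamma> L)" "\<tau> = \<sigma> \<otimes>\<^bsub>\<Gamma>Q\<^esub> \<kappa>"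
proof
  show "inv\<^bsub>\<Gamma>Q\<^esub> \<sigma> \<otimes>\<^bsub>\<Gamma>Q\<^esub> \<tau> \<in> carrier (\<Gamma> L)"
    using restrict_eq_iff_inv_mult[OF assms(1,2,4)] assms(3) by blast
  show "\<tau> = \<sigma> \<otimes>\<^bsub>\<Gamma>Q\<^esub> (inv\<^bsub>\<Gamma>Q\<^esub> \<sigma> \<otimes>\<^bsub>\<Gamma>Q\<^esub> \<tau>)"
    using assms(1,2) by (simp add: \<Gamma>Q.m_assoc[symmetric])
qed

text \<open>Two lifts of one embedding differ by a right factor from \<open>\<Gamma> L\<close>,
  which \<open>\<alpha>\<close> carries along and restriction to \<open>L\<close> ignores; so
  \<open>the_elem\<close> is applied to a singleton.\<close>

lemma plectic_act_eq:
  assumes \<alpha>: "\<alpha> \<in> carrier (plectic \<Gamma>Q (carrier (\<Gamma> L)))" and \<sigma>: "\<sigma> \<in> carrier \<Gamma>Q" and L: "L \<subseteq> Qbar"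
  shows "plectic_act L \<alpha> (restrict \<sigma> L) = restrict (\<alpha> \<sigma>) L"
proof -
  have "restrict (\<alpha> \<tau>) L = restrict (\<alpha> \<sigma>) L" if \<tau>: "\<tau> \<in> lifts L (restrict \<sigma> L)" for \<tau>
  proof -
    obtain \<kappa> where \<kappa>: "\<kappa> \<in> carrier (\<Gamma> L)" "\<tau> = \<sigma> \<otimes>\<^bsub>\<Gamma>Q\<^esub> \<kappa>"
      using lift_factor[OF \<sigma> _ _ L, of \<tau>] \<tau> by (auto simp: lifts_iff)
    then show ?thesis
      using restrict_mult_\<Gamma>[OF plecticD(2)[OF \<alpha> \<sigma>] _ L] plecticD(3)[OF \<alpha> \<sigma>] by simp
  qed
  moreover have "\<sigma> \<in> lifts L (restrict \<sigma> L)" using \<sigma> by (simp add: lifts_iff)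
  ultimately have "(\<lambda>\<tau>. restrict (\<alpha> \<tau>) L) ` lifts L (restrict \<sigma> L) = {restrict (\<alpha> \<sigma>) L}" by blast
  then show ?thesis by (simp add: plectic_act_def)
qed

section \<open>Plectic maps in coordinates\<close>

context Qbar_subfield
begin

text \<open>By equivariance a plectic map is determined by its values on representatives, and these
  are recovered from the pair. Injectivity makes \<open>inv_into\<close> in
  \<open>canonical_iso\<close> return the map constructed below.\<close>

lemma rho_inj_on:
  assumes s: "coset_reps F s"
  shows "inj_on (rho F s) (carrier (plectic \<Gamma>Q (carrier (\<Gamma> F))))"
proof (rule inj_onI)
  fix \<alpha> \<beta> assume \<alpha>: "\<alpha> \<in> carrier (plectic \<Gamma>Q (carrier (\<Gamma> F)))"
    and \<beta>: "\<beta> \<in> carrier (plectic \<Gamma>Q (carrier (\<Gamma> F)))" and eq: "rho F s \<alpha> = rho F s \<beta>"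
  show "\<alpha> = \<beta>"
  proof (rule extensionalityI[OF Bij_imp_extensional[OF plecticD(1)[OF \<alpha>]]
        Bij_imp_extensional[OF plecticD(1)[OF \<beta>]]])
    fix \<sigma> assume \<sigma>: "\<sigma> \<in> carrier \<Gamma>Q"
    define x where "x = restrict \<sigma> F"
    have x: "x \<in> embs F" unfolding x_def by (rule restrict_\<Gamma>Q_embs[OF \<sigma> F])
    note sx = coset_repsD[OF s x]
    have act: "plectic_act F \<alpha> x = plectic_act F \<beta> x"
      using fun_cong[OF arg_cong[OF eq, of fst], of x] x by (simp add: rho_def)
    have "plectic_act F \<alpha> x = restrict (\<alpha> (s x)) F"
      using plectic_act_eq[OF \<alpha> sx(1) F(2)] sx(2) by simp
    then have y: "plectic_act F \<alpha> x \<in> embs F"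
      using restrict_\<Gamma>Q_embs[OF plecticD(2)[OF \<alpha> sx(1)] F] by simp
    have "inv\<^bsub>\<Gamma>Q\<^esub> (s (plectic_act F \<alpha> x)) \<otimes>\<^bsub>\<Gamma>Q\<^esub> \<alpha> (s x) = inv\<^bsub>\<Gamma>Q\<^esub> (s (plectic_act F \<alpha> x)) \<otimes>\<^bsub>\<Gamma>Q\<^esub> \<beta> (s x)"
      using fun_cong[OF arg_cong[OF eq, of snd], of x] x act by (simp add: rho_def)
    then have eq: "\<alpha> (s x) = \<beta> (s x)"
      using plecticD(2)[OF \<alpha> sx(1)] plecticD(2)[OF \<beta> sx(1)] coset_repsD(1)[OF s y] by simp
    obtain \<kappa> where \<kappa>: "\<kappa> \<in> carrier (\<Gamma> F)" "\<sigma> = s x \<otimes>\<^bsub>\<Gamma>Q\<^esub> \<kappa>"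
      using lift_factor[OF sx(1) \<sigma> _ F(2)] sx(2) x_def by metis
    show "\<alpha> \<sigma> = \<beta> \<sigma>"
      unfolding \<kappa>(2) using plecticD(3)[OF \<alpha> sx(1) \<kappa>(1)] plecticD(3)[OF \<beta> sx(1) \<kappa>(1)] eq by simp
  qed
qed

text \<open>A formula for \<open>\<alpha>_g\<close> in which no choice of representatives
  occurs.\<close>

definition aut_plectic where
  "aut_plectic g = (\<lambda>\<sigma>\<in>carrier \<Gamma>Q. aut_gal g (aut_perm g (restrict \<sigma> F)) \<otimes>\<^bsub>\<Gamma>Q\<^esub> \<sigma>)"

context
  fixes g assumes g: "g \<in> F_auts F"
begin

lemma aut_plectic_closed: "\<sigma> \<in> carrier \<Gamma>Q \<Longrightarrow> aut_plectic g \<sigma> \<in> carrier \<Gamma>Q"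
  using aut_gal_\<Gamma>Q[OF g aut_perm_embs(1)[OF g restrict_\<Gamma>Q_embs[OF _ F]]] by (simp add: aut_plectic_def)

lemma restrict_aut_plectic:
  assumes \<sigma>: "\<sigma> \<in> carrier \<Gamma>Q"
  shows "restrict (aut_plectic g \<sigma>) F = aut_perm g (restrict \<sigma> F)"
proof -
  have x: "restrict \<sigma> F \<in> embs F" by (rule restrict_\<Gamma>Q_embs[OF \<sigma> F])
  note p = aut_perm_embs(1)[OF g x]
  show ?thesis
  proof (rule embs_eqI[OF restrict_\<Gamma>Q_embs[OF aut_plectic_closed[OF \<sigma>] F] p])
    fix a assume a: "a \<in> F"
    then have "a \<in> Qbar" using F(2) by blast
    then show "restrict (aut_plectic g \<sigma>) F a = aut_perm g (restrict \<sigma> F) a"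
      using aut_gal_perm[OF g x a] a \<sigma> aut_gal_\<Gamma>Q[OF g p] by (simp add: aut_plectic_def)
  qed
qed

text \<open>Right multiplication by \<open>\<Gamma> F\<close> leaves the restriction to
  \<open>F\<close>, hence the left factor, unchanged. A preimage of \<open>\<tau>\<close> is
  obtained by dividing on the left by the Galois element at the restriction of
  \<open>\<tau>\<close>.\<close>

lemma aut_plectic_carrier: "aut_plectic g \<in> carrier (plectic \<Gamma>Q (carrier (\<Gamma> F)))"
proof -
  have "aut_plectic g (\<sigma> \<otimes>\<^bsub>\<Gamma>Q\<^esub> \<kappa>) = aut_plectic g \<sigma> \<otimes>\<^bsub>\<Gamma>Q\<^esub> \<kappa>"
    if \<sigma>: "\<sigma> \<in> carrier \<Gamma>Q" and \<kappa>: "\<kappa> \<in> carrier (\<Gamma> F)" for \<sigma> \<kappa>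
  proof -
    have \<kappa>': "\<kappa> \<in> carrier \<Gamma>Q" using \<kappa> carrier_\<Gamma>_subset by blast
    show ?thesis
      using aut_gal_\<Gamma>Q[OF g aut_perm_embs(1)[OF g restrict_\<Gamma>Q_embs[OF \<sigma> F]]] \<sigma> \<kappa>'
        restrict_mult_\<Gamma>[OF \<sigma> \<kappa> F(2)] by (simp add: aut_plectic_def \<Gamma>Q.m_assoc)
  qed
  moreover have "bij_betw (aut_plectic g) (carrier \<Gamma>Q) (carrier \<Gamma>Q)"
    unfolding bij_betw_def
  proof
    show "inj_on (aut_plectic g) (carrier \<Gamma>Q)"
    proof (rule inj_onI)
      fix \<sigma> \<tau> assume \<sigma>: "\<sigma> \<in> carrier \<Gamma>Q" and \<tau>: "\<tau> \<in> carrier \<Gamma>Q"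
        and eq: "aut_plectic g \<sigma> = aut_plectic g \<tau>"
      \<comment> \<open>Restricting the common image to \<open>F\<close> shows that both left
        factors are the same, so they cancel.\<close>
      have "aut_perm g (restrict \<sigma> F) = aut_perm g (restrict \<tau> F)"
        using restrict_aut_plectic[OF \<sigma>] restrict_aut_plectic[OF \<tau>] eq by simp
      then show "\<sigma> = \<tau>"
        using eq \<sigma> \<tau> aut_gal_\<Gamma>Q[OF g aut_perm_embs(1)[OF g restrict_\<Gamma>Q_embs[OF \<tau> F]]]
        by (simp add: aut_plectic_def)
    qed
    have "\<tau> \<in> aut_plectic g ` carrier \<Gamma>Q" if \<tau>: "\<tau> \<in> carrier \<Gamma>Q" for \<tau>
    proof -
      define x where "x = restrict \<tau> F"
      have x: "x \<in> embs F" unfolding x_def by (rule restrict_\<Gamma>Q_embs[OF \<tau> F])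
      note gal = aut_gal_\<Gamma>Q[OF g x]
      define \<sigma> where "\<sigma> = inv\<^bsub>\<Gamma>Q\<^esub> (aut_gal g x) \<otimes>\<^bsub>\<Gamma>Q\<^esub> \<tau>"
      have \<sigma>: "\<sigma> \<in> carrier \<Gamma>Q" using gal \<tau> by (simp add: \<sigma>_def)
      have "restrict \<sigma> F = aut_src g x"
      proof (rule embs_eqI[OF restrict_\<Gamma>Q_embs[OF \<sigma> F] aut_src_embs[OF g x]])
        fix a assume a: "a \<in> F"
        then have "a \<in> Qbar" using F(2) by blast
        then show "restrict \<sigma> F a = aut_src g x a"
          using a gal \<tau> by (simp add: \<sigma>_def aut_src_def compose_eq x_def)
      qed
      then have "aut_plectic g \<sigma> = \<tau>"
        using aut_perm_embs(3)[OF g x] \<sigma> gal \<tau>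
        by (simp add: aut_plectic_def) (simp add: \<sigma>_def \<Gamma>Q.m_assoc[symmetric])
      then show ?thesis using \<sigma> by blast
    qed
    then show "aut_plectic g ` carrier \<Gamma>Q = carrier \<Gamma>Q" using aut_plectic_closed by blast
  qed
  ultimately show ?thesis by (simp add: plectic_def Bij_def aut_plectic_def)
qed

text \<open>The same pair as in \<open>beta_eq\<close>, since the map sends \<open>s x\<close> to
  \<open>\<sigma>\<close> times \<open>s x\<close>, where \<open>\<sigma>\<close> is the Galois
  element at \<open>\<pi> x\<close>.\<close>

lemma rho_aut_plectic:
  assumes s: "coset_reps F s"
  shows "rho F s (aut_plectic g) = (aut_perm g, aut_twist g s)"
proof -
  have act: "plectic_act F (aut_plectic g) x = aut_perm g x" if x: "x \<in> embs F" for x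
    using plectic_act_eq[OF aut_plectic_carrier coset_repsD(1)[OF s x] F(2)] coset_repsD[OF s x]
      restrict_aut_plectic by simp
  have "(\<lambda>x\<in>embs F. plectic_act F (aut_plectic g) x) = aut_perm g"
    using act by (auto simp: aut_perm_def intro!: restrict_ext)
  moreover have "(\<lambda>x\<in>embs F. inv\<^bsub>\<Gamma>Q\<^esub> (s (plectic_act F (aut_plectic g) x)) \<otimes>\<^bsub>\<Gamma>Q\<^esub> aut_plectic g (s x))
    = aut_twist g s"
    unfolding aut_twist_def
  proof (rule restrict_ext)
    fix x assume x: "x \<in> embs F"
    note sx = coset_repsD[OF s x] and p = aut_perm_embs(1)[OF g x]
    show "inv\<^bsub>\<Gamma>Q\<^esub> (s (plectic_act F (aut_plectic g) x)) \<otimes>\<^bsub>\<Gamma>Q\<^esub> aut_plectic g (s x)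
      = inv\<^bsub>\<Gamma>Q\<^esub> (s (aut_perm g x)) \<otimes>\<^bsub>\<Gamma>Q\<^esub> aut_gal g (aut_perm g x) \<otimes>\<^bsub>\<Gamma>Q\<^esub> s x"
      using act[OF x] sx(1,2) coset_repsD(1)[OF s p] aut_gal_\<Gamma>Q[OF g p]
      by (simp add: aut_plectic_def \<Gamma>Q.m_assoc)
  qed
  ultimately show ?thesis by (simp add: rho_def)
qed

text \<open>The automorphism and its plectic map have equal coordinates for each \<open>s\<close>,
  while the plectic map does not involve \<open>s\<close>: this is the independence of the canonical
  isomorphism from the representatives.\<close>

lemma canonical_iso_eq:
  assumes s: "coset_reps F s"
  shows "canonical_iso F s g = aut_plectic g"
  unfolding canonical_iso_def beta_eq[OF g s] rho_aut_plectic[OF s, symmetric]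
  by (rule inv_into_f_f[OF rho_inj_on[OF s] aut_plectic_carrier])

end

end

section \<open>The half-transfer map\<close>

context CM_pair
begin

sublocale Qbar_subfield F
  using F_subfield F_Qbar by (rule Qbar_subfield.intro)

section \<open>Embeddings of K above embeddings of F\<close>

context
  fixes \<Phi> s
  assumes \<Phi>: "CM_type K \<Phi>" and s: "coset_reps F s"
begin

text \<open>Coordinates on the embeddings of \<open>K\<close>: with \<open>s\<close> fixed, each
  embedding arises from exactly one exponent \<open>e\<close> and one \<open>x\<close>.\<close>

definition conj_lift where
  "conj_lift e x = restrict (conj_pow e \<otimes>\<^bsub>\<Gamma>Q\<^esub> s x) K"

lemma restrict_conj_pow_mult_F:
  assumes "\<sigma> \<in> carrier \<Gamma>Q"
  shows "restrict (conj_pow e \<otimes>\<^bsub>\<Gamma>Q\<^esub> \<sigma>) F = restrict \<sigma> F"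
proof (rule restrict_ext)
  fix z assume z: "z \<in> F"
  then have "z \<in> Qbar" using F_Qbar by blast
  then show "(conj_pow e \<otimes>\<^bsub>\<Gamma>Q\<^esub> \<sigma>) z = \<sigma> z" using conj_fixes_F[OF assms z] assms by simp
qed

lemma conj_lift:
  assumes x: "x \<in> embs F"
  shows "conj_lift e x \<in> embs K" "restrict (conj_lift e x) F = x"
    "conj_lift d x = conj_lift e x \<Longrightarrow> d = e" "conj_lift 1 x = conj_emb K (conj_lift 0 x)"
    "conj_lift 0 x = restrict (s x) K"
proof -
  note sx = coset_repsD[OF s x]
  show "conj_lift e x \<in> embs K"
    unfolding conj_lift_def using sx(1) by (intro restrict_\<Gamma>Q_embs K_subfield K_Qbar) simp
  have "restrict (conj_lift e x) F = restrict (conj_pow e \<otimes>\<^bsub>\<Gamma>Q\<^esub> s x) F"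
    unfolding conj_lift_def using F_K by (simp add: Int_absorb1)
  then show "restrict (conj_lift e x) F = x"
    using restrict_conj_pow_mult_F[OF sx(1)] sx(2) by simp
  show "conj_lift d x = conj_lift e x \<Longrightarrow> d = e"
    unfolding conj_lift_def by (rule restrict_conj_pow_inj[OF sx(1)])
  show z: "conj_lift 0 x = restrict (s x) K" using sx(1) by (simp add: conj_lift_def conj_pow_def)
  show "conj_lift 1 x = conj_emb K (conj_lift 0 x)"
    unfolding z using conj_emb_restrict[OF sx(1) K_Qbar] by (simp add: conj_lift_def conj_pow_def)
qed

text \<open>With \<open>x\<close> the restriction of \<open>\<rho>\<close> to \<open>F\<close>,
  there are only two embeddings of \<open>K\<close> above \<open>x\<close>.\<close>

lemma conj_lift_surj:
  assumes \<rho>: "\<rho> \<in> embs K"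
  obtains e x where "x \<in> embs F" "\<rho> = conj_lift e x"
proof -
  define x where "x = restrict \<rho> F"
  have x: "x \<in> embs F" unfolding x_def by (rule embs_restrict[OF \<rho> F_subfield F_K])
  note l = conj_lift[OF x]
  have "conj_lift 0 x z = \<rho> z" if "z \<in> F" for z
    using fun_cong[OF l(2)[of 0], of z] that by (simp add: x_def)
  then have "\<rho> = conj_lift 0 x \<or> \<rho> = conj_emb K (conj_lift 0 x)"
    by (rule embs_K_eq_or_conj[OF l(1) \<rho>])
  then show thesis using that[OF x] l(4) by metis
qed

text \<open>A CM type contains exactly one of the two embeddings above each \<open>x\<close>. This
  determines the exponent at \<open>x\<close>, so the definite description in
  \<open>CM_exponents\<close> is met by exactly one family.\<close>

lemma CM_type_eq: "\<Phi> = (\<lambda>x. conj_lift (CM_exponents K F \<Phi> s x) x) ` embs F"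
proof -
  have \<Phi>_embs: "\<Phi> \<subseteq> embs K" using \<Phi> unfolding CM_type_def by blast
  define a where "a = (\<lambda>x\<in>embs F. if conj_lift 0 x \<in> \<Phi> then 0 else 1 :: bit)"
  have in_\<Phi>: "conj_lift e x \<in> \<Phi> \<longleftrightarrow> e = a x" if x: "x \<in> embs F" for e x
  proof -
    note l = conj_lift[OF x]
    have "conj_lift 1 x \<notin> \<Phi>" if "conj_lift 0 x \<in> \<Phi>"
      using \<Phi> that unfolding l(4) CM_type_def by blast
    moreover have "conj_lift 1 x \<in> \<Phi>" if not_in: "conj_lift 0 x \<notin> \<Phi>"
    proof -
      obtain \<phi> where \<phi>: "\<phi> \<in> \<Phi>" "conj_lift 0 x = conj_emb K \<phi>"
        using \<Phi> not_in l(1)[of 0] unfolding CM_type_def by blast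
      have "\<phi> \<in> embs K" using \<Phi>_embs \<phi>(1) by blast
      then have "conj_lift 1 x = \<phi>" unfolding l(4) \<phi>(2) by (rule conj_emb_conj_emb)
      then show ?thesis using \<phi>(1) by simp
    qed
    ultimately show ?thesis using x by (cases e) (auto simp: a_def)
  qed
  have eq: "\<Phi> = (\<lambda>x. conj_lift (a x) x) ` embs F"
  proof
    show "\<Phi> \<subseteq> (\<lambda>x. conj_lift (a x) x) ` embs F"
    proof
      fix \<phi> assume \<phi>: "\<phi> \<in> \<Phi>"
      then have "\<phi> \<in> embs K" using \<Phi>_embs by blast
      then obtain e x where x: "x \<in> embs F" "\<phi> = conj_lift e x" using conj_lift_surj by blast
      then have "e = a x" using in_\<Phi>[OF x(1)] \<phi> by blast
      then show "\<phi> \<in> (\<lambda>x. conj_lift (a x) x) ` embs F" using x by blast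
    qed
  qed (use in_\<Phi> in blast)
  have "CM_exponents K F \<Phi> s = a"
    unfolding CM_exponents_def conj_lift_def[symmetric]
  proof (rule the_equality, goal_cases)
    case 1
    have "a \<in> extensional (embs F)" by (simp add: a_def)
    moreover have "\<Phi> = {conj_lift (a x) x |x. x \<in> embs F}" using eq by blast
    ultimately show ?case by (rule conjI)
  next
    case (2 b)
    then have b: "b \<in> extensional (embs F)" "\<Phi> = {conj_lift (b x) x |x. x \<in> embs F}" by blast+
    show ?case
    proof (rule extensionalityI[OF b(1)])
      show "a \<in> extensional (embs F)" by (simp add: a_def)
      show "b x = a x" if "x \<in> embs F" for x
        using in_\<Phi>[OF that, of "b x"] b(2) that by blast
    qed
  qed
  then show ?thesis using eq by simp
qed

section \<open>The factors of the half-transfer map\<close>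

context
  fixes g assumes g: "g \<in> F_auts F"
begin

definition half_transfer_factor where
  "half_transfer_factor x =
    inv\<^bsub>\<Gamma>Q\<^esub> (s (aut_perm g x)) \<otimes>\<^bsub>\<Gamma>Q\<^esub>
    conj_pow (CM_exponents K F \<Phi> s x + conj_exponent K (aut_twist g s x)) \<otimes>\<^bsub>\<Gamma>Q\<^esub> s (aut_perm g x)
    \<otimes>\<^bsub>\<Gamma>Q\<^esub> aut_twist g s x \<otimes>\<^bsub>\<Gamma>Q\<^esub> inv\<^bsub>\<Gamma>Q\<^esub> (s x) \<otimes>\<^bsub>\<Gamma>Q\<^esub> conj_pow (CM_exponents K F \<Phi> s x) \<otimes>\<^bsub>\<Gamma>Q\<^esub> s x"

lemma half_transfer_eq:
  "half_transfer K F \<Phi> s g = (\<Otimes>\<^bsub>\<Gamma>_ab K\<^esub>x\<in>embs F. to_ab K (half_transfer_factor x))"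
  unfolding half_transfer_def beta_eq[OF g s] Let_def prod.case half_transfer_factor_def ..

text \<open>On \<open>K\<close>, the right factors \<open>h\<close> and
  \<open>s(x)^-1 c^e s(x)\<close>, both in \<open>\<Gamma> F\<close>, turn into powers of
  \<open>c\<close> on the left, and the exponents add up.\<close>

lemma aut_plectic_conj_lift:
  assumes x: "x \<in> embs F"
  shows "restrict (aut_plectic g (conj_pow e \<otimes>\<^bsub>\<Gamma>Q\<^esub> s x)) K
      = conj_lift (e + conj_exponent K (aut_twist g s x)) (aut_perm g x)"
    and "aut_plectic g (conj_pow e \<otimes>\<^bsub>\<Gamma>Q\<^esub> s x)
      = s (aut_perm g x) \<otimes>\<^bsub>\<Gamma>Q\<^esub> aut_twist g s x \<otimes>\<^bsub>\<Gamma>Q\<^esub> inv\<^bsub>\<Gamma>Q\<^esub> (s x) \<otimes>\<^bsub>\<Gamma>Q\<^esub> conj_pow e \<otimes>\<^bsub>\<Gamma>Q\<^esub> s x"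
proof -
  note sx = coset_repsD[OF s x]
  note p = aut_perm_embs(1)[OF g x]
  note sp = coset_repsD[OF s p]
  note gal = aut_gal_\<Gamma>Q[OF g p]
  define h where "h = aut_twist g s x"
  have hF: "h \<in> carrier (\<Gamma> F)" unfolding h_def by (rule aut_twist_\<Gamma>F[OF g s x])
  then have h: "h \<in> carrier \<Gamma>Q" using carrier_\<Gamma>_subset by blast
  have gal_eq: "aut_gal g (aut_perm g x) = s (aut_perm g x) \<otimes>\<^bsub>\<Gamma>Q\<^esub> h \<otimes>\<^bsub>\<Gamma>Q\<^esub> inv\<^bsub>\<Gamma>Q\<^esub> (s x)"
    unfolding h_def aut_twist_def using x sx(1) sp(1) gal
    by (simp add: \<Gamma>Q.m_assoc) (simp add: \<Gamma>Q.m_assoc[symmetric])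
  show eq: "aut_plectic g (conj_pow e \<otimes>\<^bsub>\<Gamma>Q\<^esub> s x)
      = s (aut_perm g x) \<otimes>\<^bsub>\<Gamma>Q\<^esub> aut_twist g s x \<otimes>\<^bsub>\<Gamma>Q\<^esub> inv\<^bsub>\<Gamma>Q\<^esub> (s x) \<otimes>\<^bsub>\<Gamma>Q\<^esub> conj_pow e \<otimes>\<^bsub>\<Gamma>Q\<^esub> s x"
    using restrict_conj_pow_mult_F[OF sx(1), of e] sx(1,2) sp(1) h
    by (simp add: aut_plectic_def gal_eq h_def[symmetric] \<Gamma>Q.m_assoc)
  \<comment> \<open>This conjugate of \<open>c^e\<close> fixes \<open>F\<close> because
    \<open>c\<close> fixes the real field \<open>x(F)\<close>.\<close>
  define m where "m = inv\<^bsub>\<Gamma>Q\<^esub> (s x) \<otimes>\<^bsub>\<Gamma>Q\<^esub> (conj_pow e \<otimes>\<^bsub>\<Gamma>Q\<^esub> s x)"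
  have m: "m \<in> carrier \<Gamma>Q" unfolding m_def using sx(1) by simp
  have mF: "m \<in> carrier (\<Gamma> F)"
    unfolding m_def using restrict_conj_pow_mult_F[OF sx(1), of e] sx(1)
    by (subst restrict_eq_iff_inv_mult[symmetric]) (auto simp: F_Qbar)
  have sm: "s x \<otimes>\<^bsub>\<Gamma>Q\<^esub> m = conj_pow e \<otimes>\<^bsub>\<Gamma>Q\<^esub> s x"
    unfolding m_def using sx(1) by (simp add: \<Gamma>Q.m_assoc[symmetric])
  \<comment> \<open>The product of \<open>s x\<close> and \<open>m\<close> is both
    \<open>s x\<close> with \<open>m\<close> traded for a power of \<open>c\<close>, and
    \<open>c^e\<close> times \<open>s x\<close>; uniqueness of the exponent compares the
    two.\<close>
  have em: "conj_exponent K m = e"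
    using restrict_mult_conj_exponent[OF sx(1) mF] restrict_conj_pow_inj[OF sx(1)] unfolding sm by metis
  have "aut_plectic g (conj_pow e \<otimes>\<^bsub>\<Gamma>Q\<^esub> s x) = (s (aut_perm g x) \<otimes>\<^bsub>\<Gamma>Q\<^esub> h) \<otimes>\<^bsub>\<Gamma>Q\<^esub> m"
    unfolding eq h_def[symmetric] m_def using sx(1) sp(1) h by (simp add: \<Gamma>Q.m_assoc)
  then have "restrict (aut_plectic g (conj_pow e \<otimes>\<^bsub>\<Gamma>Q\<^esub> s x)) K
    = restrict (conj_pow e \<otimes>\<^bsub>\<Gamma>Q\<^esub> (s (aut_perm g x) \<otimes>\<^bsub>\<Gamma>Q\<^esub> h)) K"
    using restrict_mult_conj_exponent[OF _ mF, of "s (aut_perm g x) \<otimes>\<^bsub>\<Gamma>Q\<^esub> h"] em sp(1) h by simp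
  also have "\<dots> = restrict (conj_pow e \<otimes>\<^bsub>\<Gamma>Q\<^esub> (conj_pow (conj_exponent K h) \<otimes>\<^bsub>\<Gamma>Q\<^esub> s (aut_perm g x))) K"
    using restrict_mult_conj_exponent[OF sp(1) hF] sp(1) h by (intro restrict_mult_cong K_Qbar) auto
  also have "\<dots> = conj_lift (e + conj_exponent K h) (aut_perm g x)"
    unfolding conj_lift_def conj_pow_add using sp(1) by (simp add: \<Gamma>Q.m_assoc)
  finally show "restrict (aut_plectic g (conj_pow e \<otimes>\<^bsub>\<Gamma>Q\<^esub> s x)) K
      = conj_lift (e + conj_exponent K (aut_twist g s x)) (aut_perm g x)"
    by (simp add: h_def)
qed

text \<open>Powers of \<open>c\<close> are their own inverses, which turns Nekovar's product into a
  quotient of two elements with the same restriction to \<open>K\<close>.\<close>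

lemma half_transfer_factor:
  assumes x: "x \<in> embs F"
  shows "half_transfer_factor x =
      inv\<^bsub>\<Gamma>Q\<^esub> (conj_pow (CM_exponents K F \<Phi> s x + conj_exponent K (aut_twist g s x)) \<otimes>\<^bsub>\<Gamma>Q\<^esub> s (aut_perm g x))
      \<otimes>\<^bsub>\<Gamma>Q\<^esub> aut_plectic g (conj_pow (CM_exponents K F \<Phi> s x) \<otimes>\<^bsub>\<Gamma>Q\<^esub> s x)" (is "_ = inv\<^bsub>_\<^esub> ?A \<otimes>\<^bsub>_\<^esub> ?B")
    and "half_transfer_factor x \<in> carrier (\<Gamma> K)"
proof -
  note sx = coset_repsD[OF s x]
  note p = aut_perm_embs(1)[OF g x]
  note sp = coset_repsD[OF s p]
  have h: "aut_twist g s x \<in> carrier \<Gamma>Q" using aut_twist_\<Gamma>F[OF g s x] carrier_\<Gamma>_subset by blast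
  show eq: "half_transfer_factor x = inv\<^bsub>\<Gamma>Q\<^esub> ?A \<otimes>\<^bsub>\<Gamma>Q\<^esub> ?B"
    unfolding half_transfer_factor_def aut_plectic_conj_lift(2)[OF x] using sx(1) sp(1) h
    by (simp add: \<Gamma>Q.inv_mult_group conj_pow_inv \<Gamma>Q.m_assoc)
  have "?A \<in> carrier \<Gamma>Q" "?B \<in> carrier \<Gamma>Q" using aut_plectic_closed[OF g] sx(1) sp(1) by auto
  moreover have "restrict ?A K = restrict ?B K"
    using aut_plectic_conj_lift(1)[OF x] by (simp add: conj_lift_def)
  ultimately show "half_transfer_factor x \<in> carrier (\<Gamma> K)"
    unfolding eq using restrict_eq_iff_inv_mult K_Qbar by blast
qed

section \<open>Change of representatives\<close>

context
  fixes w
  assumes w: "coset_reps K w"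
    and w_conj: "\<forall>\<rho>\<in>embs K. w (conj_emb K \<rho>) = conj_Q \<otimes>\<^bsub>\<Gamma>Q\<^esub> w \<rho>"
begin

definition reps_ratio where
  "reps_ratio x = inv\<^bsub>\<Gamma>Q\<^esub> (s x) \<otimes>\<^bsub>\<Gamma>Q\<^esub> w (conj_lift 0 x)"

text \<open>Compatibility of \<open>w\<close> with conjugation makes one element serve for both
  embeddings of \<open>K\<close> above \<open>x\<close>.\<close>

lemma reps_ratio:
  assumes x: "x \<in> embs F"
  shows "reps_ratio x \<in> carrier (\<Gamma> K)"
    and "w (conj_lift e x) = (conj_pow e \<otimes>\<^bsub>\<Gamma>Q\<^esub> s x) \<otimes>\<^bsub>\<Gamma>Q\<^esub> reps_ratio x"
proof -
  note sx = coset_repsD[OF s x] and l = conj_lift[OF x]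
  note w0 = coset_repsD[OF w l(1)[of 0]]
  show "reps_ratio x \<in> carrier (\<Gamma> K)"
    unfolding reps_ratio_def using restrict_eq_iff_inv_mult[OF sx(1) w0(1) K_Qbar] w0(2) l(5) by simp
  have "w (conj_lift e x) = conj_pow e \<otimes>\<^bsub>\<Gamma>Q\<^esub> w (conj_lift 0 x)"
    using w_conj l(1)[of 0] l(4) w0(1) by (cases e) (auto simp: conj_pow_def)
  also have "\<dots> = (conj_pow e \<otimes>\<^bsub>\<Gamma>Q\<^esub> s x) \<otimes>\<^bsub>\<Gamma>Q\<^esub> reps_ratio x"
    unfolding reps_ratio_def using sx(1) w0(1)
    by (simp add: \<Gamma>Q.m_assoc) (simp add: \<Gamma>Q.m_assoc[symmetric])
  finally show "w (conj_lift e x) = (conj_pow e \<otimes>\<^bsub>\<Gamma>Q\<^esub> s x) \<otimes>\<^bsub>\<Gamma>Q\<^esub> reps_ratio x" .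
qed

definition transfer_factor where
  "transfer_factor \<phi> = inv\<^bsub>\<Gamma>Q\<^esub> (w (plectic_act K (aut_plectic g) \<phi>)) \<otimes>\<^bsub>\<Gamma>Q\<^esub> aut_plectic g (w \<phi>)"

lemma transfer_factor:
  assumes x: "x \<in> embs F"
  shows "transfer_factor (conj_lift (CM_exponents K F \<Phi> s x) x)
    = inv\<^bsub>\<Gamma>Q\<^esub> (reps_ratio (aut_perm g x)) \<otimes>\<^bsub>\<Gamma>Q\<^esub> half_transfer_factor x \<otimes>\<^bsub>\<Gamma>Q\<^esub> reps_ratio x"
proof -
  let ?e = "CM_exponents K F \<Phi> s x"
  let ?A = "conj_pow (?e + conj_exponent K (aut_twist g s x)) \<otimes>\<^bsub>\<Gamma>Q\<^esub> s (aut_perm g x)"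
  let ?B = "aut_plectic g (conj_pow ?e \<otimes>\<^bsub>\<Gamma>Q\<^esub> s x)"
  note p = aut_perm_embs(1)[OF g x]
  note sx = coset_repsD[OF s x] and sp = coset_repsD[OF s p]
  note pl = aut_plectic_carrier[OF g]
  have FK: "carrier (\<Gamma> K) \<subseteq> carrier (\<Gamma> F)" by (rule \<Gamma>_antimono[OF F_K])
  have cs: "conj_pow ?e \<otimes>\<^bsub>\<Gamma>Q\<^esub> s x \<in> carrier \<Gamma>Q" using sx(1) by simp
  have B: "?B \<in> carrier \<Gamma>Q" by (rule aut_plectic_closed[OF g cs])
  have r: "reps_ratio x \<in> carrier \<Gamma>Q" "reps_ratio (aut_perm g x) \<in> carrier \<Gamma>Q"
    using reps_ratio(1)[OF x] reps_ratio(1)[OF p] carrier_\<Gamma>_subset by blast+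
  have "plectic_act K (aut_plectic g) (conj_lift ?e x) = restrict ?B K"
    unfolding conj_lift_def using plectic_act_eq[OF _ cs K_Qbar] plectic_antimono[OF FK] pl by blast
  then have "w (plectic_act K (aut_plectic g) (conj_lift ?e x)) = ?A \<otimes>\<^bsub>\<Gamma>Q\<^esub> reps_ratio (aut_perm g x)"
    using aut_plectic_conj_lift(1)[OF x] reps_ratio(2)[OF p] by simp
  \<comment> \<open>Equivariance applies to the ratio, which lies in \<open>\<Gamma> K\<close> and
    hence in \<open>\<Gamma> F\<close>.\<close>
  moreover have "aut_plectic g (w (conj_lift ?e x)) = ?B \<otimes>\<^bsub>\<Gamma>Q\<^esub> reps_ratio x"
    unfolding reps_ratio(2)[OF x] using plecticD(3)[OF pl cs] reps_ratio(1)[OF x] FK by blast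
  ultimately show ?thesis
    unfolding transfer_factor_def half_transfer_factor(1)[OF x] using B r sp(1)
    by (simp add: \<Gamma>Q.inv_mult_group \<Gamma>Q.m_assoc)
qed

lemma half_transfer_eq_transfer:
  "half_transfer K F \<Phi> s g \<in> carrier (\<Gamma>_ab K)"
  "half_transfer K F \<Phi> s g = (\<Otimes>\<^bsub>\<Gamma>_ab K\<^esub>\<phi>\<in>\<Phi>. to_ab K (transfer_factor \<phi>))"
proof -
  interpret A: comm_group "\<Gamma>_ab K" by (rule \<Gamma>_ab_comm_group[OF K_subfield K_Qbar])
  interpret GK: group "\<Gamma> K" by (rule \<Gamma>_is_group[OF K_Qbar])
  interpret ab: group_hom "\<Gamma> K" "\<Gamma>_ab K" "to_ab K"
    by unfold_locales (rule to_ab_hom[OF K_subfield K_Qbar])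
  let ?X = "embs F"
  let ?\<phi> = "\<lambda>x. conj_lift (CM_exponents K F \<Phi> s x) x"
  let ?N = "\<lambda>x. to_ab K (half_transfer_factor x)"
  let ?T = "\<lambda>x. to_ab K (transfer_factor (?\<phi> x))"
  let ?k = "\<lambda>x. to_ab K (reps_ratio x)"
  let ?kp = "\<lambda>x. to_ab K (reps_ratio (aut_perm g x))"
  have perm: "bij_betw (aut_perm g) ?X ?X" using aut_perm_Bij[OF g] by (simp add: Bij_def)
  \<comment> \<open>The inverse is moved to the other side, so that only products of plain factors
    have to be taken over \<open>x\<close> and one cancellation remains at the end.\<close>
  have tf: "transfer_factor (?\<phi> x) \<in> carrier (\<Gamma> K)"
    "?T x \<otimes>\<^bsub>\<Gamma>_ab K\<^esub> ?kp x = ?N x \<otimes>\<^bsub>\<Gamma>_ab K\<^esub> ?k x" if x: "x \<in> ?X" for x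
  proof -
    note p = aut_perm_embs(1)[OF g x]
    note c = reps_ratio(1)[OF x] reps_ratio(1)[OF p] half_transfer_factor(2)[OF x]
    have eq: "transfer_factor (?\<phi> x)
      = inv\<^bsub>\<Gamma> K\<^esub> (reps_ratio (aut_perm g x)) \<otimes>\<^bsub>\<Gamma> K\<^esub> half_transfer_factor x \<otimes>\<^bsub>\<Gamma> K\<^esub> reps_ratio x"
      using transfer_factor[OF x] \<Gamma>_inv[OF K_Qbar c(2)] by (simp add: \<Gamma>_mult[where L = K])
    show "transfer_factor (?\<phi> x) \<in> carrier (\<Gamma> K)" unfolding eq using c by simp
    have T: "?T x = inv\<^bsub>\<Gamma>_ab K\<^esub> ?kp x \<otimes>\<^bsub>\<Gamma>_ab K\<^esub> ?N x \<otimes>\<^bsub>\<Gamma>_ab K\<^esub> ?k x" unfolding eq using c by simp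
    have c': "?kp x \<in> carrier (\<Gamma>_ab K)" "?N x \<in> carrier (\<Gamma>_ab K)" "?k x \<in> carrier (\<Gamma>_ab K)"
      using c by simp_all
    have "?T x \<otimes>\<^bsub>\<Gamma>_ab K\<^esub> ?kp x = ?kp x \<otimes>\<^bsub>\<Gamma>_ab K\<^esub> ?T x"
      unfolding T using c' by (intro A.m_comm) simp_all
    also have "\<dots> = ?N x \<otimes>\<^bsub>\<Gamma>_ab K\<^esub> ?k x"
      unfolding T using c' by (simp add: A.m_assoc[symmetric])
    finally show "?T x \<otimes>\<^bsub>\<Gamma>_ab K\<^esub> ?kp x = ?N x \<otimes>\<^bsub>\<Gamma>_ab K\<^esub> ?k x" .
  qed
  have N: "?N \<in> ?X \<rightarrow> carrier (\<Gamma>_ab K)" and T: "?T \<in> ?X \<rightarrow> carrier (\<Gamma>_ab K)"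
    and k: "?k \<in> ?X \<rightarrow> carrier (\<Gamma>_ab K)" and kp: "?kp \<in> ?X \<rightarrow> carrier (\<Gamma>_ab K)"
    using half_transfer_factor(2) tf(1) reps_ratio(1) aut_perm_embs(1)[OF g] by auto
  show "half_transfer K F \<Phi> s g \<in> carrier (\<Gamma>_ab K)"
    unfolding half_transfer_eq using N by (rule A.finprod_closed)
  \<comment> \<open>Reindexing along the permutation equates the products of the ratios at
    \<open>x\<close> and at \<open>\<pi> x\<close>.\<close>
  have "(\<Otimes>\<^bsub>\<Gamma>_ab K\<^esub>x\<in>?X. ?k x) = (\<Otimes>\<^bsub>\<Gamma>_ab K\<^esub>x\<in>aut_perm g ` ?X. ?k x)"
    using perm by (simp add: bij_betw_def)
  also have "\<dots> = (\<Otimes>\<^bsub>\<Gamma>_ab K\<^esub>x\<in>?X. ?kp x)"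
    using perm k by (intro A.finprod_reindex) (simp_all add: bij_betw_def)
  finally have k_eq: "(\<Otimes>\<^bsub>\<Gamma>_ab K\<^esub>x\<in>?X. ?k x) = (\<Otimes>\<^bsub>\<Gamma>_ab K\<^esub>x\<in>?X. ?kp x)" .
  have "(\<Otimes>\<^bsub>\<Gamma>_ab K\<^esub>x\<in>?X. ?T x) \<otimes>\<^bsub>\<Gamma>_ab K\<^esub> (\<Otimes>\<^bsub>\<Gamma>_ab K\<^esub>x\<in>?X. ?kp x)
    = (\<Otimes>\<^bsub>\<Gamma>_ab K\<^esub>x\<in>?X. ?T x \<otimes>\<^bsub>\<Gamma>_ab K\<^esub> ?kp x)"
    using A.finprod_multf[OF T kp] by simp
  also have "\<dots> = (\<Otimes>\<^bsub>\<Gamma>_ab K\<^esub>x\<in>?X. ?N x \<otimes>\<^bsub>\<Gamma>_ab K\<^esub> ?k x)"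
    using N k tf(2) by (intro A.finprod_cong') auto
  also have "\<dots> = (\<Otimes>\<^bsub>\<Gamma>_ab K\<^esub>x\<in>?X. ?N x) \<otimes>\<^bsub>\<Gamma>_ab K\<^esub> (\<Otimes>\<^bsub>\<Gamma>_ab K\<^esub>x\<in>?X. ?kp x)"
    unfolding A.finprod_multf[OF N k] k_eq ..
  finally have "(\<Otimes>\<^bsub>\<Gamma>_ab K\<^esub>x\<in>?X. ?T x) = (\<Otimes>\<^bsub>\<Gamma>_ab K\<^esub>x\<in>?X. ?N x)"
    using A.r_cancel A.finprod_closed[OF T] A.finprod_closed[OF N] A.finprod_closed[OF kp] by blast
  moreover have "(\<Otimes>\<^bsub>\<Gamma>_ab K\<^esub>\<phi>\<in>\<Phi>. to_ab K (transfer_factor \<phi>)) = (\<Otimes>\<^bsub>\<Gamma>_ab K\<^esub>x\<in>?X. ?T x)"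
  proof -
    \<comment> \<open>Restriction to \<open>F\<close> recovers \<open>x\<close>, so the product over
      \<open>\<Phi>\<close> can be indexed by the embeddings of \<open>F\<close>.\<close>
    have "inj_on ?\<phi> ?X"
      by (rule inj_onI) (metis conj_lift(2))
    moreover have "(\<lambda>\<phi>. to_ab K (transfer_factor \<phi>)) \<in> ?\<phi> ` ?X \<rightarrow> carrier (\<Gamma>_ab K)" using T by blast
    ultimately show ?thesis by (subst CM_type_eq) (rule A.finprod_reindex)
  qed
  ultimately show "half_transfer K F \<Phi> s g = (\<Otimes>\<^bsub>\<Gamma>_ab K\<^esub>\<phi>\<in>\<Phi>. to_ab K (transfer_factor \<phi>))"
    unfolding half_transfer_eq by simp
qed

end

end

end

end

theorem theorem1p1:
  fixes K F :: "complex set"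
    and \<Phi> :: "(complex \<Rightarrow> complex) set"
    and w s s' :: "(complex \<Rightarrow> complex) \<Rightarrow> complex \<Rightarrow> complex"
    and g :: "((complex \<times> complex) \<Rightarrow>\<^sub>0 int) set \<Rightarrow> ((complex \<times> complex) \<Rightarrow>\<^sub>0 int) set"
  assumes "CM_field K" and "max_totally_real_subfield F K" and "CM_type K \<Phi>"
    and "coset_reps K w"
    and "\<forall>\<rho>\<in>embs K. w (conj_emb K \<rho>) = conj_Q \<otimes>\<^bsub>\<Gamma>Q\<^esub> w \<rho>"
    and "coset_reps F s" and "coset_reps F s'"
    and "g \<in> F_auts F"
  shows "canonical_iso F s' g \<in> carrier (plectic \<Gamma>Q (carrier (\<Gamma> F))) \<and>
    canonical_iso F s' g \<in> carrier (plectic \<Gamma>Q (carrier (\<Gamma> K))) \<and>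
    half_transfer K F \<Phi> s g \<in> carrier (\<Gamma>_ab K) \<and>
    half_transfer K F \<Phi> s g =
      (\<Otimes>\<^bsub>\<Gamma>_ab K\<^esub>\<phi>\<in>\<Phi>. to_ab K
        (inv\<^bsub>\<Gamma>Q\<^esub> (w (plectic_act K (canonical_iso F s' g) \<phi>))
          \<otimes>\<^bsub>\<Gamma>Q\<^esub> canonical_iso F s' g (w \<phi>)))"
proof -
  interpret CM_pair K F using assms(1,2) by (rule CM_pair.intro)
  have \<alpha>: "aut_plectic g \<in> carrier (plectic \<Gamma>Q (carrier (\<Gamma> F)))"
    by (rule aut_plectic_carrier[OF assms(8)])
  moreover have "aut_plectic g \<in> carrier (plectic \<Gamma>Q (carrier (\<Gamma> K)))"
    using \<alpha> plectic_antimono[OF \<Gamma>_antimono[OF F_K]] by blast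
  \<comment> \<open>\<open>canonical_iso\<close> is computed with \<open>s'\<close> and
    \<open>half_transfer\<close> with \<open>s\<close>; \<open>aut_plectic\<close> involves neither,
    so the formula derived with \<open>s\<close> applies.\<close>
  moreover note half_transfer_eq_transfer[OF assms(3,6,8,4,5)]
  ultimately show ?thesis
    unfolding canonical_iso_eq[OF assms(8,7)] transfer_factor_def[OF assms(3,6,8,4,5)] by blast
qed

end
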